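(* Let $(T(t))_{t\ge 0}$ be a $C_0$-semigroup on a Banach space $X$ with generator $A$, and let $V$ be a Banach space that embeds continuously into $X$. Assume that $(T(t))_{t\ge 0}$ is ultracontractive with respect to $V$, i.e., there exist constants $C\ge 1$ and $\alpha>0$ such that \[ T(t)X\subseteq V \quad\text{and}\quad \|T(t)\|_{X\to V}\le Ct^{-\alpha}\quad\text{for all } t\in(0,1]. \] Assume moreover that $\|T(t)\|_{V\to V}\le C$ for all $t\in(0,1]$. Let $B:X\to X$ be a bounded linear operator leaving $V$ invariant (i.e. $BV\subseteq V$). Then the $C_0$-semigroup $(S(t))_{t\ge 0}$ on $X$ generated by $A+B$ is also ultracontractive with respect to $V$ with the same exponent: there exists $\widetilde C\ge 1$ such that \[ S(t)X\subseteq V\quad\text{and}\quad \|S(t)\|_{X\to V}\le \widetilde C t^{-\alpha}\quad\text{for all } t\in(0,1]. \]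
   Context: $\|\cdot\|_{X\to V}$ and $\|\cdot\|_{V\to V}$ denote the operator norms of the (restricted) operator from $X$ to $V$ and from $V$ to $V$, respectively. By the bounded perturbation theorem, $A+B$ with domain $\operatorname{dom}(A)$ generates a $C_0$-semigroup on $X$. *)

theory Defs
  imports "HOL-Analysis.Analysis"
begin

definition C0_semigroup :: "(real \<Rightarrow> 'a::banach \<Rightarrow>\<^sub>L 'a) \<Rightarrow> bool" where
  "C0_semigroup T \<longleftrightarrow>
     T 0 = id_blinfun \<and>
     (\<forall>s\<ge>0. \<forall>t\<ge>0. T (s + t) = T s o\<^sub>L T t) \<and>
     (\<forall>x. ((\<lambda>t. blinfun_apply (T t) x) \<longlongrightarrow> x) (at_right 0))"

text \<open>Unbounded operators are represented by their graphs, so that an operator includes its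
  domain \<open>Domain A\<close>, and equality of operators includes equality of domains.\<close>

definition generator :: "(real \<Rightarrow> 'a::banach \<Rightarrow>\<^sub>L 'a) \<Rightarrow> ('a \<times> 'a) set" where
  "generator T =
     {(x, y). ((\<lambda>h. (blinfun_apply (T h) x - x) /\<^sub>R h) \<longlongrightarrow> y) (at_right 0)}"

definition add_bounded :: "('a::banach \<times> 'a) set \<Rightarrow> ('a \<Rightarrow>\<^sub>L 'a) \<Rightarrow> ('a \<times> 'a) set" where
  "add_bounded A B = {(x, y + blinfun_apply B x) | x y. (x, y) \<in> A}"

text \<open>A Banach space \<open>V\<close> continuously embedded into \<open>X\<close> is a type \<open>'v::banach\<close> together with an
  injective bounded linear map \<open>j\<close> from \<open>'v\<close> to \<open>'a\<close>; as a subset of \<open>X\<close> it is \<open>range j\<close>, and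
  the norm of \<open>V\<close> is the norm of the type \<open>'v\<close>.\<close>

definition continuous_embedding :: "('v::banach \<Rightarrow>\<^sub>L 'a::banach) \<Rightarrow> bool" where
  "continuous_embedding j \<longleftrightarrow> inj (blinfun_apply j)"

text \<open>The operator \<open>R\<close> on \<open>X\<close> regarded as a map from \<open>X\<close> to \<open>V\<close>, and its restriction to a map
  from \<open>V\<close> to \<open>V\<close>. The first is meaningful if \<open>R\<close> maps \<open>X\<close> into \<open>V\<close>, the second if it maps \<open>V\<close>
  into \<open>V\<close>.\<close>

definition op_XV :: "('v::banach \<Rightarrow>\<^sub>L 'a::banach) \<Rightarrow> ('a \<Rightarrow>\<^sub>L 'a) \<Rightarrow> 'a \<Rightarrow> 'v" where
  "op_XV j R = (\<lambda>x. inv (blinfun_apply j) (blinfun_apply R x))"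

definition op_VV :: "('v::banach \<Rightarrow>\<^sub>L 'a::banach) \<Rightarrow> ('a \<Rightarrow>\<^sub>L 'a) \<Rightarrow> 'v \<Rightarrow> 'v" where
  "op_VV j R = (\<lambda>v. inv (blinfun_apply j) (blinfun_apply R (blinfun_apply j v)))"

text \<open>\<open>onorm\<close> is a real supremum and carries no information for unbounded maps, so a bound on the
  operator norm has to include boundedness.\<close>

definition opnorm_le :: "('b::real_normed_vector \<Rightarrow> 'c::real_normed_vector) \<Rightarrow> real \<Rightarrow> bool" where
  "opnorm_le f c \<longleftrightarrow> bounded_linear f \<and> onorm f \<le> c"

definition ultracontractive_bound ::
  "('v::banach \<Rightarrow>\<^sub>L 'a::banach) \<Rightarrow> (real \<Rightarrow> 'a \<Rightarrow>\<^sub>L 'a) \<Rightarrow> real \<Rightarrow> real \<Rightarrow> bool" where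
  "ultracontractive_bound j T \<alpha> C \<longleftrightarrow>
     (\<forall>t\<in>{0<..1}. range (blinfun_apply (T t)) \<subseteq> range (blinfun_apply j) \<and>
                  opnorm_le (op_XV j (T t)) (C * t powr (- \<alpha>)))"

end

theory Submission
  imports Defs
begin

text \<open>Duhamel's formula \<open>S(t)x = T(t)x + \<integral>\<^sub>0\<^sup>t T(t-s) B S(s)x ds\<close> makes \<open>S(t)x\<close> the sum of the iterates
  \<open>u\<^sub>n\<close> of \<open>u \<mapsto> \<integral>\<^sub>0\<^sup>t T(t-s) B u(s) ds\<close> started at \<open>u\<^sub>0(t) = T(t)x\<close>. Suppose \<open>u\<^sub>n(s)\<close> has norm at most \<open>d\<close> in
  \<open>X\<close> and at most \<open>d s powr (-\<alpha>)\<close> in \<open>V\<close>. Since \<open>\<alpha> \<ge> 1\<close> is allowed, neither singularity need be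
  integrable, so the integral is split at \<open>t/2\<close>: for \<open>s \<le> t/2\<close> one uses the smoothing of \<open>T(t-s)\<close> from
  \<open>X\<close> to \<open>V\<close>, for \<open>s \<ge> t/2\<close> the bounds of \<open>T(t-s)\<close> and \<open>B\<close> on \<open>V\<close>, the latter by the closed graph
  theorem. This bounds \<open>u\<^sub>n\<^sub>+\<^sub>1(t)\<close> in \<open>V\<close> by a multiple of \<open>t d t powr (-\<alpha>)\<close>, hence by
  \<open>(d/2) t powr (-\<alpha>)\<close> for small \<open>t\<close>, and the series converges in \<open>V\<close>. For larger \<open>t\<close> the semigroup
  law of \<open>S\<close> suffices.\<close>

subsection \<open>Consequences of the Baire category theorem\<close>

text \<open>Zabreiko's lemma. By Baire, the closure of some sublevel set of \<open>p\<close>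
  contains a ball, which symmetry moves to the origin. Successive approximation, as in the open
  mapping theorem, then removes the closure, and \<open>csub\<close> sums the corrections. Uniform
  boundedness and the closed graph theorem both follow from it.\<close>

lemma zabreiko:
  fixes p :: "'a::banach \<Rightarrow> real"
  assumes nonneg: "\<And>x. 0 \<le> p x"
    and scale: "\<And>c x. p (c *\<^sub>R x) = \<bar>c\<bar> * p x"
    and add: "\<And>x y. p (x + y) \<le> p x + p y"
    and csub: "\<And>f x. f sums x \<Longrightarrow> summable (\<lambda>n. p (f n)) \<Longrightarrow> p x \<le> (\<Sum>n. p (f n))"
  obtains K where "K > 0" "\<And>x. p x \<le> K * norm x"
proof -
  define A where "A n = closure {x. p x \<le> real n}" for n :: nat
  have cover: "(\<Union>n. A n) = UNIV"
  proof -
    have "x \<in> A (nat \<lceil>p x\<rceil>)" for x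
      unfolding A_def by (rule subsetD[OF closure_subset]) (use real_nat_ceiling_ge in auto)
    then show ?thesis by blast
  qed
  have "\<exists>n. interior (A n) \<noteq> {}"
  proof (rule ccontr)
    assume "\<not> ?thesis"
    then have "euclidean interior_of \<Union>(range A) = {}"
      unfolding mtopology_is_euclidean[symmetric]
      by (intro Met_TC.metric_Baire_category_alt) (auto simp: A_def complete_UNIV)
    with cover show False by simp
  qed
  then obtain n a where "a \<in> interior (A n)" by blast
  then obtain r where r: "r > 0" "ball a r \<subseteq> A n"
    by (meson mem_interior)
  have half: "norm ((1/2) *\<^sub>R (u - v)) \<le> (1/2) * (norm u + norm v)" for u v :: 'a
    using norm_triangle_ineq4[of u v] by simp
  \<comment> \<open>Points of the sublevel set near \<open>a + x\<close> and near
    \<open>a - x\<close> have half their difference near \<open>x\<close>, and \<open>p\<close> is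
    convex and even.\<close>
  have approx0: "\<exists>y. p y \<le> real n \<and> norm (x - y) < e" if "norm x < r" and "e > 0" for x e
  proof -
    have "a + x \<in> A n" "a - x \<in> A n"
      using r(2) that(1) by (auto simp: subset_iff dist_norm)
    moreover have "\<exists>y. p y \<le> real n \<and> dist y w < e" if "w \<in> A n" for w
      using that \<open>e > 0\<close> by (auto simp: A_def closure_approachable)
    ultimately obtain y z where y: "p y \<le> real n" "dist y (a + x) < e"
        and z: "p z \<le> real n" "dist z (a - x) < e"
      by metis
    have "p ((1/2) *\<^sub>R (y + (-1) *\<^sub>R z)) \<le> real n"
      using add[of y "(-1) *\<^sub>R z"] scale[of "-1" z] y(1) z(1) by (simp add: scale del: scaleR_minus_left)
    moreover have "norm (x - (1/2) *\<^sub>R (y + (-1) *\<^sub>R z)) < e"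
    proof -
      have eq: "(a + x - y) - (a - x - z) = 2 *\<^sub>R x - (y + (-1) *\<^sub>R z)"
        by (simp add: scaleR_2)
      have "x - (1/2) *\<^sub>R (y + (-1) *\<^sub>R z) = (1/2) *\<^sub>R ((a + x - y) - (a - x - z))"
        unfolding eq by (metis scaleR_right_diff_distrib scaleR_half_double scaleR_2 scaleR_add_right)
      also have "norm \<dots> \<le> (1/2) * (norm (a + x - y) + norm (a - x - z))"
        by (rule half)
      also have "\<dots> < e"
        using y(2) z(2) by (simp add: dist_norm norm_minus_commute)
      finally show ?thesis .
    qed
    ultimately show ?thesis by blast
  qed
  \<comment> \<open>Comes from rescaling a vector to norm \<open>r / 2\<close>; \<open>n + 1\<close>
    in place of \<open>n\<close> makes \<open>L\<close> positive even if
    \<open>n = 0\<close>.\<close>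
  define L where "L = 2 * (real n + 1) / r"
  have L: "L > 0" using r by (simp add: L_def)
  have approx: "\<exists>y. p y \<le> L * norm x \<and> norm (x - y) \<le> norm x / 2" for x
  proof (cases "x = 0")
    case True
    then show ?thesis using scale[of 0 0] by (intro exI[of _ 0]) auto
  next
    case False
    define c where "c = r / (2 * norm x)"
    have c: "c > 0" using r False by (simp add: c_def)
    have "norm (c *\<^sub>R x) < r" using r False by (simp add: c_def)
    then obtain y where y: "p y \<le> real n" "norm (c *\<^sub>R x - y) < c * (norm x / 2)"
      using approx0[of "c *\<^sub>R x" "c * (norm x / 2)"] c False by auto
    have "p (inverse c *\<^sub>R y) \<le> L * norm x"
    proof -
      have "p (inverse c *\<^sub>R y) = inverse c * p y" using c by (simp add: scale)
      also have "\<dots> \<le> inverse c * (real n + 1)" using y c by (intro mult_left_mono) auto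
      also have "\<dots> = L * norm x" by (simp add: c_def L_def)
      finally show ?thesis .
    qed
    moreover have "norm (x - inverse c *\<^sub>R y) \<le> norm x / 2"
    proof -
      have "x - inverse c *\<^sub>R y = inverse c *\<^sub>R (c *\<^sub>R x - y)"
        using c by (simp add: algebra_simps)
      then have "norm (x - inverse c *\<^sub>R y) = inverse c * norm (c *\<^sub>R x - y)"
        using c by simp
      also have "\<dots> \<le> inverse c * (c * (norm x / 2))"
        using y c by (intro mult_left_mono) auto
      also have "\<dots> = norm x / 2" using c by simp
      finally show ?thesis .
    qed
    ultimately show ?thesis by blast
  qed
  then have "\<forall>x. \<exists>y. p y \<le> L * norm x \<and> norm (x - y) \<le> norm x / 2" by blast
  from choice[OF this]
  obtain s where s: "\<And>x. p (s x) \<le> L * norm x" "\<And>x. norm (x - s x) \<le> norm x / 2"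
    by blast
  have "p x \<le> 2 * L * norm x" for x
  proof -
    \<comment> \<open>\<open>z k\<close> is the residual left after \<open>k\<close> corrections by
      \<open>s\<close>. It at least halves each time, so the corrections telescope to
      \<open>x\<close>.\<close>
    define z where "z k = ((\<lambda>x. x - s x) ^^ k) x" for k
    have zS: "z (Suc k) = z k - s (z k)" for k by (simp add: z_def)
    have z: "norm (z k) \<le> norm x * (1/2) ^ k" for k
    proof (induction k)
      case (Suc k)
      then show ?case using s(2)[of "z k"] by (simp add: zS)
    qed (simp add: z_def)
    have "(\<lambda>k. norm x * (1/2) ^ k) \<longlonglongrightarrow> norm x * 0"
      by (intro tendsto_mult tendsto_const LIMSEQ_power_zero) simp
    then have "z \<longlonglongrightarrow> 0"
      using z by (intro Lim_null_comparison[of z]) auto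
    from telescope_sums'[OF this] have sums: "(\<lambda>k. s (z k)) sums x"
      by (simp add: zS z_def)
    have bnd: "p (s (z k)) \<le> L * norm x * (1/2) ^ k" for k
      using order_trans[OF s(1) mult_left_mono[OF z[of k], of L]] L by (simp add: mult.assoc)
    have geo: "(\<lambda>k. L * norm x * (1/2) ^ k) sums (L * norm x * 2)"
      using sums_mult[OF geometric_sums[of "1/2::real"], of "L * norm x"] by simp
    have sm: "summable (\<lambda>k. p (s (z k)))"
      by (rule summable_comparison_test[OF _ sums_summable[OF geo]]) (use nonneg bnd in auto)
    have "p x \<le> (\<Sum>k. p (s (z k)))" by (rule csub[OF sums sm])
    also have "\<dots> \<le> L * norm x * 2"
      using suminf_le[OF bnd sm sums_summable[OF geo]] sums_unique[OF geo] by simp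
    finally show ?thesis by (simp add: mult_ac)
  qed
  with L show thesis by (intro that[of "2 * L"]) auto
qed

text \<open>Zabreiko's lemma applies to the pointwise supremum, which the hypothesis makes finite;
  countable subadditivity passes from each \<open>T n\<close> to the supremum.\<close>

lemma uniform_boundedness:
  fixes T :: "nat \<Rightarrow> 'a::banach \<Rightarrow>\<^sub>L 'b::banach"
  assumes pt: "\<And>x. bdd_above (range (\<lambda>n. norm (T n x)))"
  obtains K where "K > 0" "\<And>n. norm (T n) \<le> K"
proof -
  define p where "p x = (SUP n. norm (T n x))" for x
  have le: "norm (T n x) \<le> p x" for n x
    unfolding p_def by (intro cSUP_upper pt) auto
  have leI: "p x \<le> c" if "\<And>n. norm (T n x) \<le> c" for x c
    unfolding p_def by (intro cSUP_least that) auto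
  have nonneg: "0 \<le> p x" for x
    using order_trans[OF norm_ge_zero le] .
  have scale_le: "p (c *\<^sub>R x) \<le> \<bar>c\<bar> * p x" for c x
    by (intro leI) (auto simp: blinfun.scaleR_right intro!: mult_left_mono le)
  have scale: "p (c *\<^sub>R x) = \<bar>c\<bar> * p x" for c x
  proof (cases "c = 0")
    case True
    then show ?thesis using scale_le[of c x] nonneg[of "c *\<^sub>R x"] by simp
  next
    case False
    \<comment> \<open>The reverse inequality is \<open>scale_le\<close> for the scalar
      \<open>inverse c\<close> and the vector \<open>c *\<^sub>R x\<close>.\<close>
    have "\<bar>c\<bar> * p x \<le> \<bar>c\<bar> * (\<bar>inverse c\<bar> * p (c *\<^sub>R x))"
      using scale_le[of "inverse c" "c *\<^sub>R x"] False by (intro mult_left_mono) auto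
    also have "\<dots> = p (c *\<^sub>R x)" using False by simp
    finally show ?thesis by (intro antisym scale_le)
  qed
  have add: "p (x + y) \<le> p x + p y" for x y
    by (intro leI) (auto simp: blinfun.add_right intro: order_trans[OF norm_triangle_ineq add_mono[OF le le]])
  have csub: "p x \<le> (\<Sum>k. p (f k))" if "f sums x" "summable (\<lambda>k. p (f k))" for f x
  proof (rule leI)
    fix n
    have 1: "(\<lambda>k. T n (f k)) sums T n x"
      by (rule bounded_linear.sums[OF blinfun.bounded_linear_right that(1)])
    have 2: "summable (\<lambda>k. norm (T n (f k)))"
      by (rule summable_comparison_test'[OF that(2)]) (simp add: le)
    have "norm (T n x) \<le> (\<Sum>k. norm (T n (f k)))"
      using summable_norm[OF 2] sums_unique[OF 1] by simp
    also have "\<dots> \<le> (\<Sum>k. p (f k))" by (rule suminf_le[OF le 2 that(2)])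
    finally show "norm (T n x) \<le> (\<Sum>k. p (f k))" .
  qed
  obtain K where K: "K > 0" "\<And>x. p x \<le> K * norm x"
    using zabreiko[of p, OF nonneg scale add csub] by blast
  then have "norm (T n) \<le> K" for n
    using le by (intro norm_blinfun_bound) (auto intro: order_trans)
  with K(1) show thesis by (rule that)
qed

text \<open>Zabreiko's lemma applied to \<open>norm (F x)\<close>. Closedness enters through
  countable subadditivity: if the norms of \<open>F (f k)\<close> are summable, the images of the
  partial sums converge by completeness, and their limit must be \<open>F x\<close>.\<close>

lemma closed_graph_theorem:
  fixes F :: "'a::banach \<Rightarrow> 'b::banach"
  assumes lin: "linear F"
    and closed: "\<And>f x y. f \<longlonglongrightarrow> x \<Longrightarrow> (\<lambda>n. F (f n)) \<longlonglongrightarrow> y \<Longrightarrow> y = F x"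
  shows "bounded_linear F"
proof -
  interpret linear F by (rule lin)
  have csub: "norm (F x) \<le> (\<Sum>k. norm (F (f k)))"
    if "f sums x" "summable (\<lambda>k. norm (F (f k)))" for f x
  proof -
    have "(\<lambda>n. F (\<Sum>k<n. f k)) \<longlonglongrightarrow> (\<Sum>k. F (f k))"
      unfolding sum using summable_sums[OF summable_norm_cancel[OF that(2)]] by (simp add: sums_def)
    then have "(\<Sum>k. F (f k)) = F x"
      using that(1) by (intro closed[of "\<lambda>n. \<Sum>k<n. f k"]) (simp add: sums_def)
    then show ?thesis using summable_norm[OF that(2)] by simp
  qed
  obtain K where "\<And>x. norm (F x) \<le> K * norm x"
    using zabreiko[of "\<lambda>x. norm (F x)", OF norm_ge_zero _ _ csub]
    by (auto simp: scale add norm_triangle_ineq)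
  then show ?thesis
    by (intro bounded_linear_intro[of _ K]) (auto simp: add scale mult.commute)
qed

subsection \<open>Strongly continuous semigroups\<close>

text \<open>If the norms were unbounded near 0, there would be times \<open>t n\<close> tending to 0
  with \<open>norm (T (t n)) > n\<close>, while strong continuity bounds every orbit along them,
  against uniform boundedness. The semigroup law carries the bound near 0 to [0, 1].\<close>

lemma C0_semigroup_bounded:
  fixes T :: "real \<Rightarrow> 'a::banach \<Rightarrow>\<^sub>L 'a"
  assumes "C0_semigroup T"
  obtains M where "M \<ge> 1" "\<And>t. 0 \<le> t \<Longrightarrow> t \<le> 1 \<Longrightarrow> norm (T t) \<le> M"
proof -
  have T0: "T 0 = id_blinfun"
    and Tadd: "\<And>s t. 0 \<le> s \<Longrightarrow> 0 \<le> t \<Longrightarrow> T (s + t) = T s o\<^sub>L T t"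
    and lim: "\<And>x. ((\<lambda>t. T t x) \<longlongrightarrow> x) (at_right 0)"
    using assms by (auto simp: C0_semigroup_def)
  \<comment> \<open>A single \<open>n\<close> controls both the interval and the bound, so that the
    negation yields one sequence with small times and large norms.\<close>
  have "\<exists>n::nat. \<forall>t\<in>{0<..<1 / Suc n}. norm (T t) \<le> n"
  proof (rule ccontr)
    assume "\<not> ?thesis"
    then have neg: "\<not> (\<forall>t\<in>{0<..<1 / Suc n}. norm (T t) \<le> n)" for n :: nat by blast
    have "\<forall>n::nat. \<exists>t. 0 < t \<and> t < 1 / Suc n \<and> norm (T t) > n"
    proof
      fix n :: nat
      obtain t where "t \<in> {0<..<1 / Suc n}" "\<not> norm (T t) \<le> n" using neg[of n] unfolding Ball_def by blast
      then show "\<exists>t. 0 < t \<and> t < 1 / Suc n \<and> norm (T t) > n" by (intro exI[of _ t]) (simp add: not_le)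
    qed
    from choice[OF this] obtain t
      where t: "\<forall>n::nat. 0 < t n \<and> t n < 1 / Suc n \<and> norm (T (t n)) > n" ..
    have pos: "t n > 0" and le: "t n \<le> inverse (Suc n)" for n
      using spec[OF t, of n] by (simp_all add: inverse_eq_divide)
    have "t \<longlonglongrightarrow> 0"
      by (rule tendsto_sandwich[OF _ _ tendsto_const LIMSEQ_inverse_real_of_nat])
        (simp_all add: pos le less_imp_le del: of_nat_Suc)
    moreover have "t n \<noteq> 0" for n using pos[of n] by simp
    ultimately have "filterlim t (at_right 0) sequentially"
      by (simp add: filterlim_at pos)
    then have "(\<lambda>n. T (t n) x) \<longlonglongrightarrow> x" for x
      by (rule filterlim_compose[OF lim])
    then have "Bseq (\<lambda>n. T (t n) x)" for x
      by (intro convergent_imp_Bseq) (rule convergentI)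
    then have "bdd_above (range (\<lambda>n. norm (T (t n) x)))" for x
      using bdd_aboveI2[of UNIV "\<lambda>n. norm (T (t n) x)"] by (fastforce simp: Bseq_def)
    then obtain K where "\<And>n. norm (T (t n)) \<le> K"
      using uniform_boundedness[of "\<lambda>n. T (t n)"] by blast
    moreover obtain n :: nat where "K < n" using reals_Archimedean2 by blast
    ultimately show False using spec[OF t, of n] by (meson less_le_trans less_asym)
  qed
  then obtain n :: nat where n: "\<And>t. 0 < t \<Longrightarrow> t < 1 / Suc n \<Longrightarrow> norm (T t) \<le> n"
    unfolding Ball_def greaterThanLessThan_iff by blast
  \<comment> \<open>One more than \<open>n\<close>, so that it also bounds the norm of the identity
    and its powers are at least 1.\<close>
  define m where "m = real n + 1"
  have small: "norm (T t) \<le> m" if "0 \<le> t" "t < 1 / Suc n" for t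
  proof (cases "t = 0")
    case True
    then show ?thesis using norm_blinfun_id_le[where 'a = 'a] by (simp add: T0 m_def)
  next
    case False
    then show ?thesis using n[of t] that by (simp add: m_def)
  qed
  have pow: "norm (T (real k * t)) \<le> m ^ k" if "0 \<le> t" "t < 1 / Suc n" for k t
  proof (induction k)
    case 0
    then show ?case using norm_blinfun_id_le[where 'a = 'a] by (simp add: T0)
  next
    case (Suc k)
    have "T (real (Suc k) * t) = T t o\<^sub>L T (real k * t)"
      using Tadd[of t "real k * t"] that by (simp add: algebra_simps)
    then have "norm (T (real (Suc k) * t)) \<le> norm (T t) * norm (T (real k * t))"
      by (simp add: norm_blinfun_compose)
    also have "\<dots> \<le> m * m ^ k"
      using small[OF that] Suc by (intro mult_mono) (auto simp: m_def)
    finally show ?case by simp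
  qed
  have "norm (T t) \<le> m ^ (n + 2)" if "0 \<le> t" "t \<le> 1" for t
  proof -
    \<comment> \<open>Dividing by \<open>n + 2\<close> keeps the time step strictly below
      \<open>1 / Suc n\<close>, even for \<open>t = 1\<close>.\<close>
    have "t / real (n + 2) \<le> 1 / real (n + 2)" using that by (intro divide_right_mono) auto
    also have "\<dots> < 1 / Suc n" by (simp add: field_simps)
    finally show ?thesis using pow[of "t / real (n + 2)" "n + 2"] that by simp
  qed
  then show thesis by (intro that[of "m ^ (n + 2)"]) (auto simp: m_def simp del: power_Suc)
qed

text \<open>Joint continuity in time and vector. The uniform bound handles the change from
  \<open>f u\<close> to \<open>y\<close>. For the change of time, the operator at the smaller of the
  two times is factored out, which leaves only continuity of the orbit of \<open>y\<close> at
  0.\<close>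

lemma C0_semigroup_tendsto:
  fixes T :: "real \<Rightarrow> 'a::banach \<Rightarrow>\<^sub>L 'a"
  assumes T: "C0_semigroup T"
    and \<tau>: "(\<tau> \<longlongrightarrow> s) F" "eventually (\<lambda>u. \<tau> u \<in> {0..1}) F" and s: "s \<in> {0..1}"
    and f: "(f \<longlongrightarrow> y) F"
  shows "((\<lambda>u. T (\<tau> u) (f u)) \<longlongrightarrow> T s y) F"
proof -
  have T0: "T 0 = id_blinfun"
    and Tadd: "\<And>s t. 0 \<le> s \<Longrightarrow> 0 \<le> t \<Longrightarrow> T (s + t) = T s o\<^sub>L T t"
    and lim: "\<And>x. ((\<lambda>t. T t x) \<longlongrightarrow> x) (at_right 0)"
    using T by (auto simp: C0_semigroup_def)
  obtain M where M: "M \<ge> 1" "\<And>t. 0 \<le> t \<Longrightarrow> t \<le> 1 \<Longrightarrow> norm (T t) \<le> M"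
    using C0_semigroup_bounded[OF T] by blast
  have TM: "norm (T t x) \<le> M * norm x" if "0 \<le> t" "t \<le> 1" for t x
    using norm_blinfun[of "T t" x] mult_right_mono[OF M(2)[OF that] norm_ge_zero[of x]] by simp
  have *: "norm (T t y - T t' y) \<le> M * norm (T (t - t') y - y)" if "t' \<le> t" "0 \<le> t'" "t \<le> 1" for t t'
  proof -
    have "T t = T t' o\<^sub>L T (t - t')" using Tadd[of t' "t - t'"] that by simp
    then have "T t y - T t' y = T t' (T (t - t') y - y)" by (simp add: blinfun.diff_right)
    then show ?thesis using TM[of t'] that by simp
  qed
  have diff: "norm (T t y - T s y) \<le> M * norm (T \<bar>t - s\<bar> y - y)" if "t \<in> {0..1}" for t
    using *[of s t] *[of t s] s that
    by (cases "t \<le> s") (auto simp: abs_if norm_minus_commute)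
  \<comment> \<open>The absolute value makes the right-hand limit at 0 two-sided, so that times on
    either side of \<open>s\<close> are covered.\<close>
  have "((\<lambda>t. T \<bar>t\<bar> y) \<longlongrightarrow> y) (at 0)"
  proof (rule filterlim_split_at)
    show "((\<lambda>t. T \<bar>t\<bar> y) \<longlongrightarrow> y) (at_right 0)"
      by (rule Lim_transform_eventually[OF lim]) (simp add: eventually_at_filter)
    show "((\<lambda>t. T \<bar>t\<bar> y) \<longlongrightarrow> y) (at_left 0)"
      unfolding filterlim_at_left_to_right
      by (simp, rule Lim_transform_eventually[OF lim]) (simp add: eventually_at_filter)
  qed
  then have "isCont (\<lambda>t. T \<bar>t\<bar> y) 0" by (simp add: isCont_def T0)
  moreover have "((\<lambda>u. \<tau> u - s) \<longlongrightarrow> 0) F"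
    using tendsto_diff[OF \<tau>(1) tendsto_const[of s]] by simp
  ultimately have "((\<lambda>u. T \<bar>\<tau> u - s\<bar> y) \<longlongrightarrow> T \<bar>0\<bar> y) F"
    by (rule isCont_tendsto_compose)
  then have "((\<lambda>u. T \<bar>\<tau> u - s\<bar> y - y) \<longlongrightarrow> y - y) F"
    by (intro tendsto_diff) (auto simp: T0)
  then have l1: "((\<lambda>u. norm (T \<bar>\<tau> u - s\<bar> y - y)) \<longlongrightarrow> 0) F"
    by (auto intro: tendsto_norm_zero)
  have "((\<lambda>u. f u - y) \<longlongrightarrow> y - y) F" by (intro tendsto_diff f tendsto_const)
  then have l2: "((\<lambda>u. norm (f u - y)) \<longlongrightarrow> 0) F"
    by (auto intro: tendsto_norm_zero)
  have l3: "((\<lambda>u. M * norm (f u - y) + M * norm (T \<bar>\<tau> u - s\<bar> y - y)) \<longlongrightarrow> M * 0 + M * 0) F"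
    by (intro tendsto_intros l1 l2)
  have "((\<lambda>u. T (\<tau> u) (f u) - T s y) \<longlongrightarrow> 0) F"
  proof (rule Lim_null_comparison)
    show "\<forall>\<^sub>F u in F. norm (T (\<tau> u) (f u) - T s y)
        \<le> M * norm (f u - y) + M * norm (T \<bar>\<tau> u - s\<bar> y - y)"
      using \<tau>(2)
    proof eventually_elim
      case (elim u)
      have "T (\<tau> u) (f u) - T s y = T (\<tau> u) (f u - y) + (T (\<tau> u) y - T s y)"
        by (simp add: blinfun.diff_right)
      then have "norm (T (\<tau> u) (f u) - T s y) \<le> norm (T (\<tau> u) (f u - y)) + norm (T (\<tau> u) y - T s y)"
        by (metis norm_triangle_ineq)
      also have "\<dots> \<le> M * norm (f u - y) + M * norm (T \<bar>\<tau> u - s\<bar> y - y)"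
        using elim TM[of "\<tau> u"] diff[of "\<tau> u"] by (intro add_mono) auto
      finally show ?case .
    qed
  qed (use l3 in simp)
  then show ?thesis by (rule Lim_null[THEN iffD2])
qed

lemma C0_semigroup_continuous_on:
  fixes T :: "real \<Rightarrow> 'a::banach \<Rightarrow>\<^sub>L 'a"
  assumes "C0_semigroup T" "continuous_on U \<tau>" "\<tau> \<in> U \<rightarrow> {0..1}" "continuous_on U f"
  shows "continuous_on U (\<lambda>u. T (\<tau> u) (f u))"
  unfolding continuous_on_def
proof
  fix u assume u: "u \<in> U"
  show "((\<lambda>u. T (\<tau> u) (f u)) \<longlongrightarrow> T (\<tau> u) (f u)) (at u within U)"
    using assms(2-4) u unfolding continuous_on_def
    by (intro C0_semigroup_tendsto[OF assms(1)])
      (auto simp: eventually_at_filter Pi_iff intro!: always_eventually)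
qed

section \<open>Difference quotients, orbits in the domain and density of the domain\<close>

lemma has_vector_derivative_iff_quotient:
  "(f has_vector_derivative D) (at x within S) \<longleftrightarrow>
    ((\<lambda>y. (f y - f x) /\<^sub>R (y - x)) \<longlongrightarrow> D) (at x within S)"
proof -
  have "((\<lambda>y. norm ((f y - f x) - (y - x) *\<^sub>R D) / norm (y - x)) \<longlongrightarrow> 0) (at x within S) \<longleftrightarrow>
      ((\<lambda>y. norm ((f y - f x) /\<^sub>R (y - x) - D)) \<longlongrightarrow> 0) (at x within S)"
  proof (rule tendsto_cong)
    have "norm ((f y - f x) - (y - x) *\<^sub>R D) / norm (y - x) = norm ((f y - f x) /\<^sub>R (y - x) - D)"
      if "y \<noteq> x" for y
    proof -
      have "(f y - f x) /\<^sub>R (y - x) - D = ((f y - f x) - (y - x) *\<^sub>R D) /\<^sub>R (y - x)"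
        using that by (simp add: scaleR_right_diff_distrib)
      then show ?thesis by (simp add: divide_inverse mult.commute)
    qed
    then show "\<forall>\<^sub>F y in at x within S. norm ((f y - f x) - (y - x) *\<^sub>R D) / norm (y - x) =
        norm ((f y - f x) /\<^sub>R (y - x) - D)"
      by (simp add: eventually_at_filter)
  qed
  then show ?thesis
    unfolding has_vector_derivative_def has_derivative_iff_norm tendsto_norm_zero_iff
    by (simp add: bounded_linear_scaleR_left flip: Lim_null)
qed

lemma has_vector_derivative_at_right_quotient:
  fixes f :: "real \<Rightarrow> 'a::real_normed_vector"
  assumes "(f has_vector_derivative D) (at h within {a..b})" "a \<le> h" "h < b"
  shows "((\<lambda>k. (f (h + k) - f h) /\<^sub>R k) \<longlongrightarrow> D) (at_right 0)"
proof -
  have "at_right h = at h within {h..b}" using assms by (simp add: at_within_Icc_at_right)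
  also have "\<dots> \<le> at h within {a..b}" using assms by (intro at_le) auto
  finally have "((\<lambda>y. (f y - f h) /\<^sub>R (y - h)) \<longlongrightarrow> D) (at_right h)"
    using assms(1) unfolding has_vector_derivative_iff_quotient by (rule tendsto_mono)
  then show ?thesis
    unfolding filterlim_at_right_to_0[of _ _ h] by (simp add: add.commute)
qed

text \<open>\<open>T t\<close> commutes with \<open>T h\<close> and is continuous, so it passes
  through the difference quotients at 0.\<close>

lemma C0_semigroup_orbit_in_generator:
  assumes T: "C0_semigroup T" and xy: "(x, y) \<in> generator T" and t: "0 \<le> t"
  shows "(T t x, T t y) \<in> generator T"
proof -
  have comm: "T h (T t x) = T t (T h x)" if "0 < h" for h
    using T t that unfolding C0_semigroup_def by (metis add.commute blinfun_apply_blinfun_compose less_imp_le)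
  have "((\<lambda>h. T t ((T h x - x) /\<^sub>R h)) \<longlongrightarrow> T t y) (at_right 0)"
    using xy by (auto simp: generator_def intro: blinfun.tendsto)
  then have "((\<lambda>h. (T h (T t x) - T t x) /\<^sub>R h) \<longlongrightarrow> T t y) (at_right 0)"
    by (rule Lim_transform_eventually)
      (auto simp: eventually_at_filter comm blinfun.scaleR_right blinfun.diff_right)
  then show ?thesis by (simp add: generator_def)
qed

text \<open>The averages of the orbit of \<open>x\<close> over [0, h] lie in the domain and tend to
  \<open>x\<close> as \<open>h\<close> tends to 0.\<close>

lemma generator_densely_defined:
  fixes T :: "real \<Rightarrow> 'a::banach \<Rightarrow>\<^sub>L 'a"
  assumes T: "C0_semigroup T"
  obtains X where "\<And>n. X n \<in> Domain (generator T)" "X \<longlonglongrightarrow> x"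
proof -
  have T0: "T 0 = id_blinfun"
    and Tadd: "\<And>s t. 0 \<le> s \<Longrightarrow> 0 \<le> t \<Longrightarrow> T (s + t) = T s o\<^sub>L T t"
    using T by (auto simp: C0_semigroup_def)
  define G where "G u = integral {0..u} (\<lambda>s. T s x)" for u
  have cont: "continuous_on {0..1} (\<lambda>s. T s x)"
    by (rule C0_semigroup_continuous_on[OF T]) auto
  have int: "(\<lambda>s. T s x) integrable_on {a..b}" if "0 \<le> a" "b \<le> 1" for a b
    using that by (intro integrable_continuous_real continuous_on_subset[OF cont]) auto
  have deriv: "((\<lambda>k. (G (h + k) - G h) /\<^sub>R k) \<longlongrightarrow> T h x) (at_right 0)" if "0 \<le> h" "h < 1" for h
    using that unfolding G_def
    by (intro has_vector_derivative_at_right_quotient[of _ _ _ 0 1] integral_has_vector_derivative cont) auto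
  have dom: "(G h, T h x - x) \<in> generator T" if h: "0 < h" "h < 1" for h
  proof -
    \<comment> \<open>\<open>T k\<close> translates the interval of integration by \<open>k\<close>,
      so \<open>T k (G h) - G h\<close> is the difference of integrals over intervals of length
      \<open>k\<close> at \<open>h\<close> and at 0.\<close>
    have eq: "T k (G h) = G (h + k) - G k" if k: "0 < k" "k < 1 - h" for k
    proof -
      have "T k (G h) = integral {0..h} (\<lambda>s. T k (T s x))"
        unfolding G_def using integral_linear[OF int blinfun.bounded_linear_right, of 0 h "T k"] h
        by (simp add: o_def)
      also have "\<dots> = integral {0..h} ((\<lambda>s. T s x) \<circ> (+) k)"
        using k Tadd by (intro integral_cong) auto
      also have "\<dots> = integral {k..h + k} (\<lambda>s. T s x)"
        by (simp add: integral_shift_Icc_real)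
      also have "\<dots> = G (h + k) - G k"
        unfolding G_def using Henstock_Kurzweil_Integration.integral_combine[OF _ _ int, of 0 k "h + k"] h k
        by (simp add: algebra_simps)
      finally show ?thesis .
    qed
    have "((\<lambda>k. (G (h + k) - G h) /\<^sub>R k - (G (0 + k) - G 0) /\<^sub>R k) \<longlongrightarrow> T h x - T 0 x) (at_right 0)"
      using h by (intro tendsto_diff deriv) auto
    then have "((\<lambda>k. (T k (G h) - G h) /\<^sub>R k) \<longlongrightarrow> T h x - T 0 x) (at_right 0)"
    proof (rule Lim_transform_eventually)
      have "\<forall>\<^sub>F k in at_right 0. k \<in> {0<..<1 - h}"
        using h by (intro eventually_at_right_real) auto
      then show "\<forall>\<^sub>F k in at_right 0. (G (h + k) - G h) /\<^sub>R k - (G (0 + k) - G 0) /\<^sub>R k =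
          (T k (G h) - G h) /\<^sub>R k"
      proof eventually_elim
        case (elim k)
        have "G 0 = 0" by (simp add: G_def)
        then show ?case using eq[of k] elim by (simp add: scaleR_right_diff_distrib)
      qed
    qed
    then show ?thesis by (simp add: generator_def T0)
  qed
  have dom': "G h /\<^sub>R h \<in> Domain (generator T)" if h: "0 < h" "h < 1" for h
  proof -
    have "((\<lambda>k. inverse h *\<^sub>R ((T k (G h) - G h) /\<^sub>R k)) \<longlongrightarrow> inverse h *\<^sub>R (T h x - x)) (at_right 0)"
      using dom[OF h] by (intro tendsto_intros) (simp add: generator_def)
    then have "(G h /\<^sub>R h, (T h x - x) /\<^sub>R h) \<in> generator T"
      by (simp add: generator_def blinfun.scaleR_right algebra_simps)
    then show ?thesis by blast
  qed
  \<comment> \<open>\<open>Suc (Suc n)\<close> keeps the times strictly below 1, as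
    \<open>dom'\<close> demands.\<close>
  define X where "X n = G (inverse (Suc (Suc n))) /\<^sub>R inverse (Suc (Suc n))" for n
  show thesis
  proof (rule that)
    show "X n \<in> Domain (generator T)" for n
      unfolding X_def by (rule dom') (auto simp: field_simps)
    have "filterlim (\<lambda>n. inverse (real (Suc (Suc n)))) (at_right 0) sequentially"
      using LIMSEQ_Suc[OF LIMSEQ_inverse_real_of_nat] by (simp add: filterlim_at)
    moreover have "((\<lambda>k. G k /\<^sub>R k) \<longlongrightarrow> x) (at_right 0)"
      using deriv[of 0] by (simp add: G_def T0)
    ultimately show "X \<longlonglongrightarrow> x"
      unfolding X_def by (rule filterlim_compose[rotated])
  qed
qed

subsection \<open>Duhamel's formula\<close>

text \<open>By the product rule the generator of \<open>T\<close> contributes twice with opposite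
  signs, and only the term with \<open>B\<close> survives. Since a generator supplies only
  right-hand quotients at 0, the two one-sided derivatives are computed separately.\<close>

lemma perturbed_semigroup_derivative:
  fixes T S :: "real \<Rightarrow> 'a::banach \<Rightarrow>\<^sub>L 'a"
  assumes T: "C0_semigroup T" and S: "C0_semigroup S"
    and gen: "generator S = add_bounded (generator T) B"
    and xy: "(x, y) \<in> generator S" and s: "0 < s" "s < t" "t \<le> 1"
  shows "((\<lambda>s. T (t - s) (S s x)) has_vector_derivative T (t - s) (B (S s x))) (at s)"
proof -
  have Tadd: "\<And>s t. 0 \<le> s \<Longrightarrow> 0 \<le> t \<Longrightarrow> T (s + t) = T s o\<^sub>L T t"
    using T by (auto simp: C0_semigroup_def)
  have Sadd: "\<And>s t. 0 \<le> s \<Longrightarrow> 0 \<le> t \<Longrightarrow> S (s + t) = S s o\<^sub>L S t"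
    using S by (auto simp: C0_semigroup_def)
  define z where "z = S s x"
  define w where "w = S s y"
  have zw: "(z, w) \<in> generator S"
    unfolding z_def w_def using s by (intro C0_semigroup_orbit_in_generator S xy) auto
  then have Sz: "((\<lambda>h. (S h z - z) /\<^sub>R h) \<longlongrightarrow> w) (at_right 0)"
    by (simp add: generator_def)
  have "(z, w - B z) \<in> generator T"
    using zw unfolding gen by (auto simp: add_bounded_def)
  then have Tz: "((\<lambda>h. (T h z - z) /\<^sub>R h) \<longlongrightarrow> w - B z) (at_right 0)"
    by (simp add: generator_def)
  have Sx: "((\<lambda>h. (S h x - x) /\<^sub>R h) \<longlongrightarrow> y) (at_right 0)"
    using xy by (simp add: generator_def)
  have ev: "\<forall>\<^sub>F h in at_right (0::real). h \<in> {0<..<min s (t - s)}"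
    using s by (intro eventually_at_right_real) auto
  let ?\<psi> = "\<lambda>s. T (t - s) (S s x)"
  let ?q = "\<lambda>u. (?\<psi> u - ?\<psi> s) /\<^sub>R (u - s)"
  \<comment> \<open>To the right of \<open>s\<close>, \<open>T (t - s - h)\<close> is a common
    factor of both values, which leaves the difference of the two quotients at
    \<open>z\<close>.\<close>
  have "((\<lambda>h. T (t - s - h) ((S h z - z) /\<^sub>R h - (T h z - z) /\<^sub>R h)) \<longlongrightarrow> T (t - s) (w - (w - B z)))
      (at_right 0)"
  proof (rule C0_semigroup_tendsto[OF T])
    show "((\<lambda>h. t - s - h) \<longlongrightarrow> t - s) (at_right 0)" by (auto intro!: tendsto_eq_intros)
    show "\<forall>\<^sub>F h in at_right 0. t - s - h \<in> {0..1}"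
      by (rule eventually_mono[OF ev]) (use s in auto)
    show "((\<lambda>h. (S h z - z) /\<^sub>R h - (T h z - z) /\<^sub>R h) \<longlongrightarrow> w - (w - B z)) (at_right 0)"
      by (rule tendsto_diff[OF Sz Tz])
  qed (use s in auto)
  moreover have "\<forall>\<^sub>F h in at_right 0.
      T (t - s - h) ((S h z - z) /\<^sub>R h - (T h z - z) /\<^sub>R h) = ?q (h + s)"
    using ev
  proof eventually_elim
    case (elim h)
    have "T (t - s) = T (t - s - h) o\<^sub>L T h" "S (h + s) = S h o\<^sub>L S s"
      using Tadd[of "t - s - h" h] Sadd[of h s] elim s by simp_all
    then show ?case
      by (simp add: z_def blinfun.diff_right blinfun.scaleR_right scaleR_right_diff_distrib
          diff_diff_eq add.commute)
  qed
  ultimately have right: "(?q \<longlongrightarrow> T (t - s) (B z)) (at_right s)"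
    unfolding filterlim_at_right_to_0[of _ _ s] by (simp add: Lim_transform_eventually)
  \<comment> \<open>To the left of \<open>s\<close>, adding and subtracting
    \<open>T (t - s + h) (S s x)\<close> separates the semigroups. The quotient of \<open>S\<close>
    is now taken at \<open>x\<close>, behind the factor \<open>S (s - h)\<close>.\<close>
  have "((\<lambda>h. T (t - s + h) (S (s - h) ((S h x - x) /\<^sub>R h)) - T (t - s) ((T h z - z) /\<^sub>R h)) \<longlongrightarrow>
      T (t - s) w - T (t - s) (w - B z)) (at_right 0)"
    unfolding w_def
  proof (intro tendsto_diff C0_semigroup_tendsto[OF T] C0_semigroup_tendsto[OF S] Sx)
    show "((\<lambda>h. t - s + h) \<longlongrightarrow> t - s) (at_right 0)" "((\<lambda>h. s - h) \<longlongrightarrow> s) (at_right 0)"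
      by (auto intro!: tendsto_eq_intros)
    show "\<forall>\<^sub>F h in at_right 0. t - s + h \<in> {0..1}" "\<forall>\<^sub>F h in at_right 0. s - h \<in> {0..1}"
      by (rule eventually_mono[OF ev]; use s in auto)+
  qed (use s Tz in \<open>auto simp: w_def\<close>)
  then have "((\<lambda>h. T (t - s + h) (S (s - h) ((S h x - x) /\<^sub>R h)) - T (t - s) ((T h z - z) /\<^sub>R h)) \<longlongrightarrow>
      T (t - s) (B z)) (at_right 0)"
    by (simp add: blinfun.diff_right)
  moreover have "\<forall>\<^sub>F h in at_right 0.
      T (t - s + h) (S (s - h) ((S h x - x) /\<^sub>R h)) - T (t - s) ((T h z - z) /\<^sub>R h) = ?q (- (h + - s))"
    using ev
  proof eventually_elim
    case (elim h)
    have "T (t - s + h) = T (t - s) o\<^sub>L T h" "S s = S (s - h) o\<^sub>L S h"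
      using Tadd[of "t - s" h] Sadd[of "s - h" h] elim s by simp_all
    then show ?case
      by (simp add: z_def blinfun.diff_right blinfun.scaleR_right scaleR_right_diff_distrib algebra_simps)
  qed
  ultimately have left: "(?q \<longlongrightarrow> T (t - s) (B z)) (at_left s)"
    unfolding filterlim_at_left_to_right[of _ _ s] filterlim_at_right_to_0[of _ _ "- s"]
    by (rule Lim_transform_eventually)
  from filterlim_split_at[OF left right] show ?thesis
    by (simp add: has_vector_derivative_iff_quotient z_def)
qed

lemma continuous_on_variation_integrand:
  assumes T: "C0_semigroup T" and t: "t \<in> {0..1}" and f: "continuous_on {0..t} f"
  shows "continuous_on {0..1} (\<lambda>\<sigma>. T (t * (1 - \<sigma>)) (blinfun_apply B (f (t * \<sigma>))))"
proof (rule C0_semigroup_continuous_on[OF T])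
  show "(\<lambda>\<sigma>. t * (1 - \<sigma>)) \<in> {0..1} \<rightarrow> {0..1}"
    using t by (auto intro!: mult_le_one)
  show "continuous_on {0..1} (\<lambda>\<sigma>. blinfun_apply B (f (t * \<sigma>)))"
    using t by (intro continuous_intros continuous_on_compose2[OF f])
      (auto intro: mult_left_le)
qed (intro continuous_intros)

text \<open>The derivative of \<open>T (t - s) (S s x)\<close> is integrated over [0, t], rescaled
  to [0, 1]; the endpoint values are \<open>T t x\<close> and \<open>S t x\<close>.\<close>

lemma duhamel_generator:
  fixes T S :: "real \<Rightarrow> 'a::banach \<Rightarrow>\<^sub>L 'a"
  assumes T: "C0_semigroup T" and S: "C0_semigroup S"
    and gen: "generator S = add_bounded (generator T) B"
    and x: "x \<in> Domain (generator S)" and t: "t \<in> {0..1}"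
  shows "S t x - T t x = t *\<^sub>R integral {0..1} (\<lambda>\<sigma>. T (t * (1 - \<sigma>)) (B (S (t * \<sigma>) x)))"
proof (cases "t = 0")
  case True
  then show ?thesis using T S by (simp add: C0_semigroup_def)
next
  case False
  obtain y where xy: "(x, y) \<in> generator S" using x by blast
  let ?\<phi> = "\<lambda>\<sigma>. T (t - t * \<sigma>) (S (t * \<sigma>) x)"
  have "((\<lambda>\<sigma>. t *\<^sub>R T (t - t * \<sigma>) (B (S (t * \<sigma>) x))) has_integral (?\<phi> 1 - ?\<phi> 0)) {0..1}"
  proof (rule fundamental_theorem_of_calculus_interior)
    show "continuous_on {0..1} ?\<phi>"
    proof (intro C0_semigroup_continuous_on[OF T] C0_semigroup_continuous_on[OF S] continuous_intros)
      have "0 \<le> t * \<sigma> \<and> t * \<sigma> \<le> t" if "\<sigma> \<in> {0..1}" for \<sigma>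
        using t that by (auto intro: mult_left_le)
      with t show "(\<lambda>\<sigma>. t - t * \<sigma>) \<in> {0..1} \<rightarrow> {0..1}" "(\<lambda>\<sigma>. t * \<sigma>) \<in> {0..1} \<rightarrow> {0..1}"
        by fastforce+
    qed
    fix \<sigma> :: real assume \<sigma>: "\<sigma> \<in> {0<..<1}"
    have "((\<lambda>\<sigma>. t * \<sigma>) has_vector_derivative t) (at \<sigma>)"
      by (auto intro!: derivative_eq_intros)
    moreover have "((\<lambda>s. T (t - s) (S s x)) has_vector_derivative T (t - t * \<sigma>) (B (S (t * \<sigma>) x))) (at (t * \<sigma>))"
      using \<sigma> t False by (intro perturbed_semigroup_derivative[OF T S gen xy]) auto
    ultimately show "(?\<phi> has_vector_derivative t *\<^sub>R T (t - t * \<sigma>) (B (S (t * \<sigma>) x))) (at \<sigma>)"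
      using vector_diff_chain_at by (fastforce simp: o_def)
  qed simp
  from integral_unique[OF this] show ?thesis
    using T S by (simp add: C0_semigroup_def algebra_simps)
qed

text \<open>Both sides depend continuously on \<open>x\<close>, the integral by the estimate
  \<open>bound\<close>, so the formula extends from the dense domain to the whole space.\<close>

lemma duhamel:
  fixes T S :: "real \<Rightarrow> 'a::banach \<Rightarrow>\<^sub>L 'a"
  assumes T: "C0_semigroup T" and S: "C0_semigroup S"
    and gen: "generator S = add_bounded (generator T) B" and t: "t \<in> {0..1}"
  shows "S t x - T t x = t *\<^sub>R integral {0..1} (\<lambda>\<sigma>. T (t * (1 - \<sigma>)) (B (S (t * \<sigma>) x)))"
proof -
  obtain M where M: "M \<ge> 1" "\<And>t. 0 \<le> t \<Longrightarrow> t \<le> 1 \<Longrightarrow> norm (T t) \<le> M"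
    using C0_semigroup_bounded[OF T] by blast
  obtain N where N: "N \<ge> 1" "\<And>t. 0 \<le> t \<Longrightarrow> t \<le> 1 \<Longrightarrow> norm (S t) \<le> N"
    using C0_semigroup_bounded[OF S] by blast
  let ?g = "\<lambda>x \<sigma>. T (t * (1 - \<sigma>)) (B (S (t * \<sigma>) x))"
  have cont: "continuous_on {0..1} (?g x)" for x
    using t by (intro continuous_on_variation_integrand[OF T t] C0_semigroup_continuous_on[OF S]) auto
  have bound: "norm (?g x \<sigma>) \<le> M * (norm B * (N * norm x))" if "\<sigma> \<in> {0..1}" for x \<sigma>
  proof -
    have 1: "0 \<le> t * (1 - \<sigma>)" "t * (1 - \<sigma>) \<le> 1" "0 \<le> t * \<sigma>" "t * \<sigma> \<le> 1"
      using t that by (auto intro: mult_le_one)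
    have "norm (?g x \<sigma>) \<le> norm (T (t * (1 - \<sigma>))) * (norm B * (norm (S (t * \<sigma>)) * norm x))"
      by (meson mult_left_mono norm_blinfun norm_ge_zero order_trans)
    also have "\<dots> \<le> M * (norm B * (N * norm x))"
      using M N 1 by (intro mult_mono mult_nonneg_nonneg order_refl) auto
    finally show ?thesis .
  qed
  obtain X where X: "\<And>n. X n \<in> Domain (generator S)" "X \<longlonglongrightarrow> x"
    using generator_densely_defined[OF S, of x] by blast
  have "(\<lambda>n. integral {0..1} (?g (X n)) - integral {0..1} (?g x)) \<longlonglongrightarrow> 0"
  proof (rule Lim_null_comparison)
    show "\<forall>\<^sub>F n in sequentially. norm (integral {0..1} (?g (X n)) - integral {0..1} (?g x))
        \<le> M * (norm B * (N * norm (X n - x)))"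
    proof (rule always_eventually, rule allI)
      fix n
      have "integral {0..1} (?g (X n)) - integral {0..1} (?g x) = integral {0..1} (?g (X n - x))"
        by (subst integral_diff[symmetric])
          (auto intro!: integrable_continuous_real cont simp: blinfun.diff_right)
      then show "norm (integral {0..1} (?g (X n)) - integral {0..1} (?g x)) \<le> M * (norm B * (N * norm (X n - x)))"
        using integral_bound[OF _ cont bound, of "X n - x"] by simp
    qed
    have "(\<lambda>n. norm (X n - x)) \<longlonglongrightarrow> 0"
      by (intro tendsto_norm_zero LIM_zero X)
    then show "(\<lambda>n. M * (norm B * (N * norm (X n - x)))) \<longlonglongrightarrow> 0"
      by (intro tendsto_mult_right_zero)
  qed
  from LIM_zero_cancel[OF this]
  have "(\<lambda>n. t *\<^sub>R integral {0..1} (?g (X n))) \<longlonglongrightarrow> t *\<^sub>R integral {0..1} (?g x)"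
    by (intro tendsto_intros)
  moreover have "t *\<^sub>R integral {0..1} (?g (X n)) = S t (X n) - T t (X n)" for n
    using duhamel_generator[OF T S gen X(1) t] by simp
  ultimately have "(\<lambda>n. S t (X n) - T t (X n)) \<longlonglongrightarrow> t *\<^sub>R integral {0..1} (?g x)" by simp
  moreover have "(\<lambda>n. S t (X n) - T t (X n)) \<longlonglongrightarrow> S t x - T t x"
    by (intro tendsto_intros X)
  ultimately show ?thesis by (rule LIMSEQ_unique[rotated])
qed

subsection \<open>Norm bounds in the embedded space\<close>

text \<open>Membership in V and the norm bound are expressed together, without the inverse of
  \<open>j\<close>, whose values off the range are arbitrary.\<close>

definition bounded_preimage :: "('v::banach \<Rightarrow>\<^sub>L 'a::banach) \<Rightarrow> 'a \<Rightarrow> real \<Rightarrow> bool" where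
  "bounded_preimage j y c \<longleftrightarrow> (\<exists>v. j v = y \<and> norm v \<le> c)"

lemma bounded_preimage_mono: "bounded_preimage j y c \<Longrightarrow> c \<le> d \<Longrightarrow> bounded_preimage j y d"
  unfolding bounded_preimage_def by (blast intro: order_trans)

lemma bounded_preimage_scaleR:
  "bounded_preimage j y c \<Longrightarrow> 0 \<le> r \<Longrightarrow> bounded_preimage j (r *\<^sub>R y) (r * c)"
  unfolding bounded_preimage_def by (metis abs_of_nonneg blinfun.scaleR_right mult_left_mono norm_scaleR)

text \<open>The preimages converge absolutely in the complete space V, and continuity of
  \<open>j\<close> identifies the image of their sum with the sum in X.\<close>

lemma bounded_preimage_sums:
  assumes u: "u sums y" and b: "\<And>n. bounded_preimage j (u n) (c n)" and c: "c sums d"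
  shows "bounded_preimage j y d"
proof -
  from b obtain w where w: "\<And>n. j (w n) = u n" "\<And>n. norm (w n) \<le> c n"
    unfolding bounded_preimage_def by metis
  have sm: "summable (\<lambda>n. norm (w n))"
    by (rule summable_comparison_test'[OF sums_summable[OF c]]) (simp add: w(2))
  have "(\<lambda>n. j (w n)) sums j (suminf w)"
    by (rule bounded_linear.sums[OF blinfun.bounded_linear_right summable_sums[OF summable_norm_cancel[OF sm]]])
  then have "j (suminf w) = y" using u sums_unique2 by (auto simp: w(1))
  moreover have "norm (suminf w) \<le> d"
    using summable_norm[OF sm] suminf_le[OF w(2) sm sums_summable[OF c]] sums_unique[OF c] by simp
  ultimately show ?thesis unfolding bounded_preimage_def by blast
qed

text \<open>The integrand may be discontinuous at \<open>1\<close>, and \<open>V\<close> need not be separable, so that the Bochner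
  integral of the library is not available in \<open>V\<close>.\<close>

lemma bounded_preimage_integral:
  fixes f :: "real \<Rightarrow> 'v::banach" and j :: "'v \<Rightarrow>\<^sub>L 'a::banach"
  assumes g: "continuous_on {0..1} g"
    and f: "\<And>b. 0 \<le> b \<Longrightarrow> b < 1 \<Longrightarrow> continuous_on {0..b} f"
    and eq: "\<And>s. 0 \<le> s \<Longrightarrow> s < 1 \<Longrightarrow> j (f s) = g s"
    and m: "\<And>s. 0 \<le> s \<Longrightarrow> s < 1 \<Longrightarrow> norm (f s) \<le> m"
  shows "bounded_preimage j (integral {0..1} g) m"
proof -
  \<comment> \<open>The integrals over \<open>{0..b n}\<close> stay where \<open>f\<close> is
    continuous; the bound \<open>m\<close> makes them a Cauchy sequence as \<open>b n\<close> tends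
    to 1.\<close>
  define b where "b n = 1 - inverse (real (Suc n))" for n
  define F where "F n = integral {0..b n} f" for n
  have b: "0 \<le> b n" "b n < 1" for n by (auto simp: b_def field_simps)
  have blim: "b \<longlonglongrightarrow> 1"
    unfolding b_def using tendsto_diff[OF tendsto_const LIMSEQ_inverse_real_of_nat, of 1] by simp
  have diff: "norm (F n - F k) \<le> m * \<bar>b n - b k\<bar>" if "b k \<le> b n" for n k
  proof -
    have "integral {0..b k} f + integral {b k..b n} f = integral {0..b n} f"
      using b that by (intro Henstock_Kurzweil_Integration.integral_combine integrable_continuous_real f)
    then have "F n - F k = integral {b k..b n} f" by (simp add: F_def algebra_simps)
    also have "norm \<dots> \<le> m * (b n - b k)"
    proof (rule integral_bound[OF that])
      show "continuous_on {b k..b n} f"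
        by (rule continuous_on_subset[OF f[OF b]]) (use b in auto)
      show "norm (f t) \<le> m" if "t \<in> {b k..b n}" for t
        using that b[of k] b[of n] by (intro m) auto
    qed
    finally show ?thesis using that by simp
  qed
  have m0: "0 \<le> m" using order_trans[OF norm_ge_zero m[of 0]] by simp
  have diff': "norm (F n - F k) \<le> m * \<bar>b n - b k\<bar>" for n k
    using diff[of n k] diff[of k n] by (cases "b k \<le> b n") (auto simp: norm_minus_commute abs_minus_commute)
  have "Cauchy F"
  proof (rule CauchyI)
    fix e :: real assume e: "0 < e"
    \<comment> \<open>\<open>m + 1\<close> is the divisor because \<open>m\<close> may be 0.\<close>
    then obtain N where N: "\<And>n k. n \<ge> N \<Longrightarrow> k \<ge> N \<Longrightarrow> norm (b n - b k) < e / (m + 1)"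
      using CauchyD[OF LIMSEQ_imp_Cauchy[OF blim], of "e / (m + 1)"] m0 by auto
    have "norm (F n - F k) < e" if "n \<ge> N" "k \<ge> N" for n k
    proof -
      have "norm (F n - F k) \<le> (m + 1) * \<bar>b n - b k\<bar>"
        using diff'[of n k] mult_right_mono[of m "m + 1" "\<bar>b n - b k\<bar>"] by simp
      also have "\<dots> < (m + 1) * (e / (m + 1))"
        using N[OF that] m0 by (intro mult_strict_left_mono) auto
      finally show ?thesis using m0 by simp
    qed
    then show "\<exists>N. \<forall>n\<ge>N. \<forall>k\<ge>N. norm (F n - F k) < e" by blast
  qed
  then obtain w where w: "F \<longlonglongrightarrow> w" using Cauchy_convergent_iff convergent_def by blast
  have "norm (F n) \<le> m" for n
  proof -
    have "norm (F n) \<le> m * (b n - 0)"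
      unfolding F_def using b[of n] by (intro integral_bound f m) auto
    also have "\<dots> \<le> m" using b[of n] m0 by (auto intro: mult_left_le)
    finally show ?thesis .
  qed
  then have "norm w \<le> m" by (intro Lim_norm_ubound[OF _ w]) auto
  moreover have "j w = integral {0..1} g"
  proof (rule LIMSEQ_unique)
    show "(\<lambda>n. j (F n)) \<longlonglongrightarrow> j w" by (intro blinfun.tendsto tendsto_const w)
    have "j (F n) = integral {0..b n} g" for n
    proof -
      have "j (F n) = integral {0..b n} (\<lambda>s. j (f s))"
        unfolding F_def
        using integral_linear[OF integrable_continuous_real[OF f[OF b]] blinfun.bounded_linear_right, of n j]
        by (simp add: o_def)
      also have "\<dots> = integral {0..b n} g"
        using b[of n] by (intro integral_cong eq) auto
      finally show ?thesis .
    qed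
    moreover have "(\<lambda>n. integral {0..b n} g) \<longlonglongrightarrow> integral {0..1} g"
    proof (rule continuous_on_tendsto_compose[OF _ blim])
      show "continuous_on {0..1} (\<lambda>u. integral {0..u} g)"
        by (intro indefinite_integral_continuous_1 integrable_continuous_real g)
    qed (use b in \<open>auto intro!: always_eventually less_imp_le\<close>)
    ultimately show "(\<lambda>n. j (F n)) \<longlonglongrightarrow> integral {0..1} g" by simp
  qed
  ultimately show ?thesis unfolding bounded_preimage_def by blast
qed

section \<open>Operator norms between X and V\<close>

lemma opnorm_le_op_XV:
  fixes j :: "'v::banach \<Rightarrow>\<^sub>L 'a::banach" and R :: "'a \<Rightarrow>\<^sub>L 'a"
  assumes inj: "inj (blinfun_apply j)" and c: "0 \<le> c"
    and R: "\<And>x. bounded_preimage j (R x) (norm x * c)"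
  shows "range (blinfun_apply R) \<subseteq> range (blinfun_apply j) \<and> opnorm_le (op_XV j R) c"
proof -
  have op: "j (op_XV j R x) = R x" "norm (op_XV j R x) \<le> norm x * c" for x
  proof -
    obtain v where "j v = R x" "norm v \<le> norm x * c"
      using R[of x] unfolding bounded_preimage_def by blast
    then show "j (op_XV j R x) = R x" "norm (op_XV j R x) \<le> norm x * c"
      unfolding op_XV_def using inv_f_f[OF inj, of v] by simp_all
  qed
  \<comment> \<open>Linearity is checked after applying the injective \<open>j\<close>, where it is
    the linearity of \<open>R\<close>.\<close>
  have "op_XV j R (x + y) = op_XV j R x + op_XV j R y" for x y
    by (rule injD[OF inj]) (simp add: op blinfun.add_right)
  moreover have "op_XV j R (r *\<^sub>R x) = r *\<^sub>R op_XV j R x" for r x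
    by (rule injD[OF inj]) (simp add: op blinfun.scaleR_right)
  ultimately have "bounded_linear (op_XV j R)"
    using op(2) by (rule bounded_linear_intro)
  moreover have "onorm (op_XV j R) \<le> c"
    using op(2) c by (intro onorm_bound) (auto simp: mult.commute)
  moreover have "R x \<in> range (blinfun_apply j)" for x
    using op(1)[of x] by (metis rangeI)
  ultimately show ?thesis by (auto simp: opnorm_le_def)
qed

lemma opnorm_leD:
  assumes "opnorm_le f c"
  shows "norm (f x) \<le> c * norm x"
proof -
  have "norm (f x) \<le> onorm f * norm x"
    using assms by (intro onorm) (simp add: opnorm_le_def)
  also have "\<dots> \<le> c * norm x"
    using assms by (intro mult_right_mono) (auto simp: opnorm_le_def)
  finally show ?thesis .
qed

lemma op_XV_apply:
  assumes "ultracontractive_bound j T \<alpha> C" "s \<in> {0<..1}"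
  shows "j (op_XV j (T s) x) = T s x"
proof -
  have "T s x \<in> range (blinfun_apply j)"
    using assms unfolding ultracontractive_bound_def by blast
  then show ?thesis unfolding op_XV_def by (rule f_inv_into_f)
qed

text \<open>Invariance of V alone makes the restriction of \<open>B\<close> bounded on V, by the
  closed graph theorem: \<open>j\<close> carries limits in V to limits in X, where \<open>B\<close>
  is continuous, and injectivity returns the resulting equation to V.\<close>

lemma restriction_bounded_linear:
  fixes j :: "'v::banach \<Rightarrow>\<^sub>L 'a::banach"
  assumes inj: "inj (blinfun_apply j)"
    and B: "blinfun_apply B ` range (blinfun_apply j) \<subseteq> range (blinfun_apply j)"
  shows "bounded_linear (op_VV j B)" "\<And>v. j (op_VV j B v) = B (j v)"
proof -
  show op: "j (op_VV j B v) = B (j v)" for v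
    using B by (auto simp: op_VV_def intro!: f_inv_into_f)
  show "bounded_linear (op_VV j B)"
  proof (rule closed_graph_theorem)
    show "linear (op_VV j B)"
    proof (rule linearI)
      show "op_VV j B (x + y) = op_VV j B x + op_VV j B y" for x y
        by (rule injD[OF inj]) (simp add: op blinfun.add_right)
      show "op_VV j B (r *\<^sub>R x) = r *\<^sub>R op_VV j B x" for r x
        by (rule injD[OF inj]) (simp add: op blinfun.scaleR_right)
    qed
    fix f x y assume "f \<longlonglongrightarrow> x" "(\<lambda>n. op_VV j B (f n)) \<longlonglongrightarrow> y"
    then have "(\<lambda>n. B (j (f n))) \<longlonglongrightarrow> B (j x)" "(\<lambda>n. j (op_VV j B (f n))) \<longlonglongrightarrow> j y"
      by (auto intro!: blinfun.tendsto tendsto_const)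
    then have "j y = B (j x)" unfolding op by (rule LIMSEQ_unique[rotated])
    then show "y = op_VV j B x" by (intro injD[OF inj]) (simp add: op)
  qed
qed

subsection \<open>The perturbation series\<close>

text \<open>The integral of \<open>T (t - s) (B (f s))\<close> over \<open>0 \<le> s \<le> t\<close>, with \<open>s = t * \<sigma>\<close> substituted so that the
  domain of integration does not depend on \<open>t\<close>.\<close>

definition variation ::
  "(real \<Rightarrow> 'a::banach \<Rightarrow>\<^sub>L 'a) \<Rightarrow> ('a \<Rightarrow>\<^sub>L 'a) \<Rightarrow> (real \<Rightarrow> 'a) \<Rightarrow> real \<Rightarrow> 'a" where
  "variation T B f t = t *\<^sub>R integral {0..1} (\<lambda>\<sigma>. T (t * (1 - \<sigma>)) (B (f (t * \<sigma>))))"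

lemma variation_cong:
  assumes "0 \<le> t" "\<And>s. s \<in> {0..t} \<Longrightarrow> f s = g s"
  shows "variation T B f t = variation T B g t"
proof -
  have "f (t * \<sigma>) = g (t * \<sigma>)" if "\<sigma> \<in> {0..1}" for \<sigma>
    using assms(1) that by (intro assms(2)) (auto intro: mult_left_le)
  then show ?thesis unfolding variation_def by (auto intro!: integral_cong)
qed

lemma variation_add:
  assumes T: "C0_semigroup T" and t: "t \<in> {0..1}"
    and "continuous_on {0..t} f" "continuous_on {0..t} g"
  shows "variation T B (\<lambda>s. f s + g s) t = variation T B f t + variation T B g t"
  unfolding variation_def
  by (simp add: blinfun.add_right integral_add integrable_continuous_real assms
      continuous_on_variation_integrand[OF T t] scaleR_add_right)

text \<open>After the substitution this is a parameter integral over a fixed interval with a jointly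
  continuous integrand.\<close>

lemma continuous_on_variation:
  assumes T: "C0_semigroup T" and t: "t \<le> 1" and f: "continuous_on {0..t} f"
  shows "continuous_on {0..t} (variation T B f)"
proof -
  let ?U = "{0..t} \<times> cbox 0 (1::real)"
  have le: "s * \<sigma> \<le> t" if "0 \<le> s" "s \<le> t" "0 \<le> \<sigma>" "\<sigma> \<le> 1" for s \<sigma>
    using that mult_mono[of s t \<sigma> 1] by simp
  have "continuous_on ?U (\<lambda>p. T (fst p * (1 - snd p)) (B (f (fst p * snd p))))"
  proof (rule C0_semigroup_continuous_on[OF T])
    show "(\<lambda>p. fst p * (1 - snd p)) \<in> ?U \<rightarrow> {0..1}"
      using t le by (force intro: order_trans[of _ t])
    show "continuous_on ?U (\<lambda>p. B (f (fst p * snd p)))"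
      using le by (intro continuous_intros continuous_on_compose2[OF f]) auto
  qed (intro continuous_intros)
  then have "continuous_on ?U (\<lambda>(s, \<sigma>). T (s * (1 - \<sigma>)) (B (f (s * \<sigma>))))"
    by (simp add: split_beta)
  from integral_continuous_on_param[OF this] show ?thesis
    unfolding variation_def by (intro continuous_intros) simp
qed

text \<open>The factor \<open>t\<close> is kept because it makes the map a contraction on short
  intervals.\<close>

lemma norm_variation_le:
  assumes T: "C0_semigroup T" and M: "\<And>t. 0 \<le> t \<Longrightarrow> t \<le> 1 \<Longrightarrow> norm (T t) \<le> M" and t: "t \<in> {0..1}"
    and f: "continuous_on {0..t} f" and c: "\<And>s. s \<in> {0..t} \<Longrightarrow> norm (f s) \<le> c"
  shows "norm (variation T B f t) \<le> t * (M * norm B) * c"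
proof -
  have "norm (integral {0..1} (\<lambda>\<sigma>. T (t * (1 - \<sigma>)) (B (f (t * \<sigma>))))) \<le> M * (norm B * c) * (1 - 0)"
  proof (rule integral_bound[OF _ continuous_on_variation_integrand[OF T t f]])
    fix \<sigma> :: real assume \<sigma>: "\<sigma> \<in> {0..1}"
    have 1: "0 \<le> t * (1 - \<sigma>)" "t * (1 - \<sigma>) \<le> 1" "t * \<sigma> \<in> {0..t}"
      using t \<sigma> by (auto intro: mult_le_one mult_left_le)
    have "norm (T (t * (1 - \<sigma>)) (B (f (t * \<sigma>)))) \<le> norm (T (t * (1 - \<sigma>))) * (norm B * norm (f (t * \<sigma>)))"
      by (meson mult_left_mono norm_blinfun norm_ge_zero order_trans)
    also have "\<dots> \<le> M * (norm B * c)"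
      using M[OF 1(1,2)] c[OF 1(3)]
      by (intro mult_mono mult_nonneg_nonneg order_refl) (auto intro: order_trans[OF norm_ge_zero])
    finally show "norm (T (t * (1 - \<sigma>)) (B (f (t * \<sigma>)))) \<le> M * (norm B * c)" .
  qed simp
  from mult_left_mono[OF this, of t] show ?thesis
    using t by (simp add: variation_def mult_ac)
qed

text \<open>Up to \<sigma> = 1/2 the singular time is \<open>t * (1 - \<sigma>)\<close>, beyond it
  \<open>t * \<sigma>\<close>; either is at least \<open>t / 2\<close>. For fixed \<open>t\<close>
  the integrand is therefore bounded in V, however large \<alpha> is.\<close>

lemma bounded_preimage_variation:
  fixes j :: "'v::banach \<Rightarrow>\<^sub>L 'a::banach" and B :: "'a \<Rightarrow>\<^sub>L 'a"
  assumes T: "C0_semigroup T" and inj: "inj (blinfun_apply j)"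
    and C: "0 \<le> C" and \<alpha>: "0 < \<alpha>"
    and XV: "ultracontractive_bound j T \<alpha> C"
    and VV: "\<forall>t\<in>{0<..1}. opnorm_le (op_VV j (T t)) C"
    and B: "\<And>v. j (B\<^sub>V v) = B (j v)" "\<And>v. norm (B\<^sub>V v) \<le> b * norm v" "0 \<le> b"
    and t: "t \<in> {0<..1}" and f: "continuous_on {0..t} f"
    and c: "\<And>s. s \<in> {0..t} \<Longrightarrow> norm (f s) \<le> c"
    and d: "\<And>s. s \<in> {0<..t} \<Longrightarrow> bounded_preimage j (f s) (d * s powr (- \<alpha>))"
  shows "bounded_preimage j (variation T B f t) (t * (C * (t / 2) powr (- \<alpha>) * (norm B * c + b * d)))"
proof -
  have Tadd: "\<And>s t. 0 \<le> s \<Longrightarrow> 0 \<le> t \<Longrightarrow> T (s + t) = T s o\<^sub>L T t"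
    using T by (auto simp: C0_semigroup_def)
  have c0: "0 \<le> c" using order_trans[OF norm_ge_zero c[of 0]] t by simp
  have d0: "0 \<le> d"
  proof -
    have "0 \<le> d * t powr (- \<alpha>)"
      using d[of t] t unfolding bounded_preimage_def by (auto intro: order_trans[OF norm_ge_zero])
    then show ?thesis using t by (auto simp: zero_le_mult_iff)
  qed
  note op = op_XV_apply[OF XV]
  \<comment> \<open>The integrand with values in V. Only \<sigma> < 1 matters, since at \<sigma> = 1
    the time is 0 and there is no smoothing.\<close>
  define h where "h \<sigma> = op_XV j (T (t * (1 - \<sigma>))) (B (f (t * \<sigma>)))" for \<sigma>
  have \<tau>: "t * (1 - \<sigma>) \<in> {0<..1}" if "0 \<le> \<sigma>" "\<sigma> < 1" for \<sigma>
    using t that by (auto intro: mult_le_one)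
  let ?P = "(t / 2) powr (- \<alpha>)"
  have P: "s powr (- \<alpha>) \<le> ?P" if "t / 2 \<le> s" for s
    using t that \<alpha> by (intro powr_mono2') auto
  have "bounded_preimage j (integral {0..1} (\<lambda>\<sigma>. T (t * (1 - \<sigma>)) (B (f (t * \<sigma>)))))
      (C * ?P * (norm B * c + b * d))"
  proof (rule bounded_preimage_integral)
    show "continuous_on {0..1} (\<lambda>\<sigma>. T (t * (1 - \<sigma>)) (B (f (t * \<sigma>))))"
      using t by (intro continuous_on_variation_integrand[OF T _ f]) auto
    show "j (h \<sigma>) = T (t * (1 - \<sigma>)) (B (f (t * \<sigma>)))" if "0 \<le> \<sigma>" "\<sigma> < 1" for \<sigma>
      unfolding h_def by (rule op[OF \<tau>[OF that]])
  next
    fix a :: real assume a: "0 \<le> a" "a < 1"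
    \<comment> \<open>Factoring out \<open>T \<epsilon>\<close>, which maps \<open>X\<close> continuously into \<open>V\<close>, turns strong continuity in \<open>X\<close>
      into continuity in \<open>V\<close>.\<close>
    define \<epsilon> where "\<epsilon> = t * (1 - a)"
    have \<epsilon>: "\<epsilon> \<in> {0<..1}" unfolding \<epsilon>_def by (rule \<tau>[OF a])
    have bl: "bounded_linear (op_XV j (T \<epsilon>))"
      using XV \<epsilon> by (auto simp: ultracontractive_bound_def opnorm_le_def)
    have rest: "0 \<le> t * (1 - \<sigma>) - \<epsilon>" "t * (1 - \<sigma>) - \<epsilon> \<le> 1" "0 \<le> t * \<sigma>" "t * \<sigma> \<le> t"
      if "\<sigma> \<in> {0..a}" for \<sigma>
    proof -
      show "0 \<le> t * (1 - \<sigma>) - \<epsilon>"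
        using that t by (simp add: \<epsilon>_def mult_left_mono)
      have "t * (1 - \<sigma>) \<le> 1" using \<tau>[of \<sigma>] that a by auto
      then show "t * (1 - \<sigma>) - \<epsilon> \<le> 1" using \<epsilon> by auto
    qed (use that t a in \<open>auto intro: mult_left_le\<close>)
    have "continuous_on {0..a} (\<lambda>\<sigma>. op_XV j (T \<epsilon>) (T (t * (1 - \<sigma>) - \<epsilon>) (B (f (t * \<sigma>)))))"
    proof (intro bounded_linear.continuous_on[OF bl] C0_semigroup_continuous_on[OF T])
      show "continuous_on {0..a} (\<lambda>\<sigma>. B (f (t * \<sigma>)))"
        using rest by (intro continuous_intros continuous_on_compose2[OF f]) auto
    qed (use rest in \<open>auto intro!: continuous_intros\<close>)
    moreover have "op_XV j (T \<epsilon>) (T (t * (1 - \<sigma>) - \<epsilon>) (B (f (t * \<sigma>)))) = h \<sigma>" if "\<sigma> \<in> {0..a}" for \<sigma>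
    proof -
      have "T (t * (1 - \<sigma>)) = T \<epsilon> o\<^sub>L T (t * (1 - \<sigma>) - \<epsilon>)"
        using Tadd[of \<epsilon> "t * (1 - \<sigma>) - \<epsilon>"] \<epsilon> rest[OF that] by simp
      then show ?thesis by (simp add: h_def op_XV_def)
    qed
    ultimately show "continuous_on {0..a} h" by (rule continuous_on_eq)
  next
    fix \<sigma> :: real assume \<sigma>: "0 \<le> \<sigma>" "\<sigma> < 1"
    show "norm (h \<sigma>) \<le> C * ?P * (norm B * c + b * d)"
    proof (cases "\<sigma> \<le> 1 / 2")
      case True
      have "norm (h \<sigma>) \<le> C * (t * (1 - \<sigma>)) powr (- \<alpha>) * norm (B (f (t * \<sigma>)))"
        unfolding h_def using XV \<tau>[OF \<sigma>] by (intro opnorm_leD) (auto simp: ultracontractive_bound_def)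
      also have "\<dots> \<le> C * ?P * (norm B * c)"
      proof (intro mult_mono mult_nonneg_nonneg)
        have "t / 2 \<le> t * (1 - \<sigma>)" using True t mult_left_mono[of "1/2" "1 - \<sigma>" t] by simp
        then show "(t * (1 - \<sigma>)) powr (- \<alpha>) \<le> ?P" by (rule P)
        have "norm (B (f (t * \<sigma>))) \<le> norm B * norm (f (t * \<sigma>))" by (rule norm_blinfun)
        also have "\<dots> \<le> norm B * c"
          using \<sigma> t by (intro mult_left_mono c) (auto intro: mult_left_le)
        finally show "norm (B (f (t * \<sigma>))) \<le> norm B * c" .
      qed (use C in auto)
      also have "\<dots> \<le> C * ?P * (norm B * c + b * d)"
        using C B(3) d0 by (intro mult_left_mono) auto
      finally show ?thesis .
    next
      case False
      then have s: "t * \<sigma> \<in> {0<..t}" "t / 2 \<le> t * \<sigma>"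
        using \<sigma> t mult_left_mono[of "1/2" \<sigma> t] by (auto intro: mult_left_le)
      from d[OF s(1)] obtain v where v: "j v = f (t * \<sigma>)" "norm v \<le> d * (t * \<sigma>) powr (- \<alpha>)"
        unfolding bounded_preimage_def by blast
      \<comment> \<open>As \<open>B (f (t * \<sigma>)) = j (B\<^sub>V v)\<close>, the bound of the
        semigroup on V applies, which has no singularity as \<sigma> approaches 1.\<close>
      have "h \<sigma> = op_VV j (T (t * (1 - \<sigma>))) (B\<^sub>V v)"
        by (simp add: h_def op_XV_def op_VV_def B v)
      also have "norm \<dots> \<le> C * norm (B\<^sub>V v)"
        using VV \<tau>[OF \<sigma>] by (intro opnorm_leD) auto
      also have "\<dots> \<le> C * (b * (d * ?P))"
      proof (rule mult_left_mono[OF _ C])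
        have "norm v \<le> d * ?P" using v(2) mult_left_mono[OF P[OF s(2)] d0] by linarith
        then show "norm (B\<^sub>V v) \<le> b * (d * ?P)"
          using B(2)[of v] mult_left_mono[OF _ B(3)] order_trans by blast
      qed
      also have "\<dots> \<le> C * ?P * (norm B * c + b * d)"
        using C c0 by (simp add: algebra_simps)
      finally show ?thesis .
    qed
  qed
  from bounded_preimage_scaleR[OF this, of t] show ?thesis
    using t by (simp add: variation_def)
qed

text \<open>Each application costs a factor of at most \<open>r * (M * norm B)\<close>, hence at
  most one half. Continuity is part of the induction because the norm estimate needs it.\<close>

lemma variation_iterate:
  fixes T :: "real \<Rightarrow> 'a::banach \<Rightarrow>\<^sub>L 'a"
  assumes T: "C0_semigroup T" and M: "\<And>t. 0 \<le> t \<Longrightarrow> t \<le> 1 \<Longrightarrow> norm (T t) \<le> M" "0 \<le> M"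
    and r: "0 \<le> r" "r \<le> 1" "r * (M * norm B) \<le> 1 / 2"
    and f: "continuous_on {0..r} f" and c: "\<And>s. s \<in> {0..r} \<Longrightarrow> norm (f s) \<le> c"
  shows "continuous_on {0..r} ((variation T B ^^ n) f) \<and>
    (\<forall>t\<in>{0..r}. norm ((variation T B ^^ n) f t) \<le> c * (1 / 2) ^ n)"
proof (induction n)
  case 0
  then show ?case using f c by simp
next
  case (Suc n)
  let ?u = "(variation T B ^^ n) f"
  have c0: "0 \<le> c" using order_trans[OF norm_ge_zero c[of 0]] r by simp
  have "norm (variation T B ?u t) \<le> c * (1 / 2) ^ Suc n" if t: "t \<in> {0..r}" for t
  proof -
    have "norm (variation T B ?u t) \<le> t * (M * norm B) * (c * (1 / 2) ^ n)"
    proof (rule norm_variation_le[OF T M(1)])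
      show "t \<in> {0..1}" using t r by auto
      show "continuous_on {0..t} ?u"
        using Suc by (rule continuous_on_subset[OF conjunct1]) (use t in auto)
      show "norm (?u s) \<le> c * (1 / 2) ^ n" if "s \<in> {0..t}" for s
        using bspec[OF conjunct2[OF Suc], of s] that t by simp
    qed
    also have "\<dots> \<le> 1 / 2 * (c * (1 / 2) ^ n)"
    proof (rule mult_right_mono)
      have "t * (M * norm B) \<le> r * (M * norm B)"
        using t M(2) by (intro mult_right_mono mult_nonneg_nonneg) auto
      with r(3) show "t * (M * norm B) \<le> 1 / 2" by linarith
    qed (use c0 in simp)
    finally show ?thesis by simp
  qed
  moreover have "continuous_on {0..r} (variation T B ?u)"
    using Suc by (intro continuous_on_variation[OF T r(2)]) (rule conjunct1)
  ultimately show ?case by simp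
qed

text \<open>One constant serves for the norm in X and for the weighted norm in V, so the estimate
  for a single variation can be repeated, and both bounds are halved each time.\<close>

lemma bounded_preimage_variation_iterate:
  fixes j :: "'v::banach \<Rightarrow>\<^sub>L 'a::banach" and B :: "'a \<Rightarrow>\<^sub>L 'a"
  assumes T: "C0_semigroup T" and M: "\<And>t. 0 \<le> t \<Longrightarrow> t \<le> 1 \<Longrightarrow> norm (T t) \<le> M" "0 \<le> M"
    and inj: "inj (blinfun_apply j)" and C: "0 \<le> C" and \<alpha>: "0 < \<alpha>"
    and XV: "ultracontractive_bound j T \<alpha> C"
    and VV: "\<forall>t\<in>{0<..1}. opnorm_le (op_VV j (T t)) C"
    and B: "\<And>v. j (B\<^sub>V v) = B (j v)" "\<And>v. norm (B\<^sub>V v) \<le> b * norm v" "0 \<le> b"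
    and r: "0 < r" "r \<le> 1" "r * (M * norm B) \<le> 1 / 2"
      "r * (C * 2 powr \<alpha> * (norm B + b)) \<le> 1 / 2"
    and f: "continuous_on {0..r} f" and c: "\<And>s. s \<in> {0..r} \<Longrightarrow> norm (f s) \<le> c"
    and fV: "\<And>s. s \<in> {0<..r} \<Longrightarrow> bounded_preimage j (f s) (c * s powr (- \<alpha>))"
    and t: "t \<in> {0<..r}"
  shows "bounded_preimage j ((variation T B ^^ n) f t) (c * (1 / 2) ^ n * t powr (- \<alpha>))"
  using t
proof (induction n arbitrary: t)
  case 0
  then show ?case using fV by simp
next
  case (Suc n)
  let ?u = "(variation T B ^^ n) f"
  let ?d = "c * (1 / 2) ^ n"
  have c0: "0 \<le> ?d" using order_trans[OF norm_ge_zero c[of 0]] r by simp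
  have u: "continuous_on {0..r} ?u" "\<And>t. t \<in> {0..r} \<Longrightarrow> norm (?u t) \<le> ?d"
    using variation_iterate[OF T M _ r(2,3) f c] r by auto
  have "bounded_preimage j (variation T B ?u t)
      (t * (C * (t / 2) powr (- \<alpha>) * (norm B * ?d + b * ?d)))"
  proof (rule bounded_preimage_variation[OF T inj C \<alpha> XV VV B])
    show "continuous_on {0..t} ?u" by (rule continuous_on_subset[OF u(1)]) (use Suc in auto)
  qed (use Suc u r in auto)
  moreover have "t * (C * (t / 2) powr (- \<alpha>) * (norm B * ?d + b * ?d)) \<le> c * (1 / 2) ^ Suc n * t powr (- \<alpha>)"
  proof -
    \<comment> \<open>Source of the factor \<open>2 powr \<alpha>\<close> in the smallness condition
      on \<open>r\<close>.\<close>
    have "(t / 2) powr (- \<alpha>) = 2 powr \<alpha> * t powr (- \<alpha>)"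
      using Suc(2) by (simp add: powr_divide powr_minus divide_simps)
    then have "t * (C * (t / 2) powr (- \<alpha>) * (norm B * ?d + b * ?d)) =
        t * (C * 2 powr \<alpha> * (norm B + b)) * (?d * t powr (- \<alpha>))"
      by (simp add: algebra_simps)
    also have "\<dots> \<le> 1 / 2 * (?d * t powr (- \<alpha>))"
    proof (rule mult_right_mono)
      have "t * (C * 2 powr \<alpha> * (norm B + b)) \<le> r * (C * 2 powr \<alpha> * (norm B + b))"
        using Suc(2) C B(3) by (intro mult_right_mono) auto
      with r(4) show "t * (C * 2 powr \<alpha> * (norm B + b)) \<le> 1 / 2" by linarith
    qed (use c0 in auto)
    finally show ?thesis by simp
  qed
  ultimately show ?case by (simp add: bounded_preimage_mono)
qed

text \<open>By Duhamel's formula the orbit of \<open>S\<close> is the orbit of \<open>T\<close> plus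
  the variation of the orbit of \<open>S\<close>. Iterating this leaves the remainder
  \<open>?v n\<close>, which has a geometric bound, and the terms \<open>?u n\<close>
  telescope.\<close>

lemma perturbed_semigroup_series:
  fixes T S :: "real \<Rightarrow> 'a::banach \<Rightarrow>\<^sub>L 'a"
  assumes T: "C0_semigroup T" and S: "C0_semigroup S"
    and gen: "generator S = add_bounded (generator T) B"
    and M: "\<And>t. 0 \<le> t \<Longrightarrow> t \<le> 1 \<Longrightarrow> norm (T t) \<le> M" "0 \<le> M"
    and r: "0 \<le> r" "r \<le> 1" "r * (M * norm B) \<le> 1 / 2" and t: "t \<in> {0..r}"
  shows "(\<lambda>n. (variation T B ^^ n) (\<lambda>s. T s x) t) sums S t x"
proof -
  let ?u = "\<lambda>n. (variation T B ^^ n) (\<lambda>s. T s x)"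
  let ?v = "\<lambda>n. (variation T B ^^ n) (\<lambda>s. S s x)"
  obtain N where N: "\<And>t. 0 \<le> t \<Longrightarrow> t \<le> 1 \<Longrightarrow> norm (S t) \<le> N"
    using C0_semigroup_bounded[OF S] by blast
  have Tc: "continuous_on {0..r} (\<lambda>s. T s x)"
    using r by (intro C0_semigroup_continuous_on[OF T] continuous_intros) auto
  have Sc: "continuous_on {0..r} (\<lambda>s. S s x)"
    using r by (intro C0_semigroup_continuous_on[OF S] continuous_intros) auto
  have TM: "norm (T s x) \<le> M * norm x" if "s \<in> {0..r}" for s
    using norm_blinfun[of "T s" x] mult_right_mono[OF M(1)[of s] norm_ge_zero[of x]] that r by auto
  have SN: "norm (S s x) \<le> N * norm x" if "s \<in> {0..r}" for s
    using norm_blinfun[of "S s" x] mult_right_mono[OF N[of s] norm_ge_zero[of x]] that r by auto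
  note u = variation_iterate[OF T M r Tc TM]
  note v = variation_iterate[OF T M r Sc SN]
  \<comment> \<open>Duhamel's formula for \<open>n = 0\<close>; the induction applies the additive
    map \<open>variation T B\<close> to both sides.\<close>
  have step: "?v n s = ?u n s + ?v (Suc n) s" if "s \<in> {0..r}" for n s
    using that
  proof (induction n arbitrary: s)
    case 0
    then show ?case using duhamel[OF T S gen, of s x] r by (simp add: variation_def algebra_simps)
  next
    case (Suc n)
    have "?v (Suc n) s = variation T B (\<lambda>s. ?u n s + ?v (Suc n) s) s"
      using Suc by (simp, intro variation_cong) auto
    also have "\<dots> = ?u (Suc n) s + ?v (Suc (Suc n)) s"
      using Suc(2) r u[of n] v[of "Suc n"]
      by (simp, intro variation_add[OF T]) (auto intro: continuous_on_subset)
    finally show ?case .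
  qed
  have "(\<lambda>n. ?v n t) \<longlonglongrightarrow> 0"
  proof (rule Lim_null_comparison)
    show "\<forall>\<^sub>F n in sequentially. norm (?v n t) \<le> N * norm x * (1 / 2) ^ n"
      using v t by (intro always_eventually) blast
    show "(\<lambda>n. N * norm x * (1 / 2) ^ n) \<longlonglongrightarrow> 0"
      by (intro tendsto_mult_right_zero LIMSEQ_power_zero) simp
  qed
  from telescope_sums'[OF this] have "(\<lambda>n. ?v n t - ?v (Suc n) t) sums S t x" by simp
  moreover have "?v n t - ?v (Suc n) t = ?u n t" for n using step[OF t, of n] by simp
  ultimately show ?thesis by simp
qed

section \<open>Smoothing by the perturbed semigroup for short times and its extension to (0,
  1]\<close>

theorem theorem1p1:
  fixes T S :: "real \<Rightarrow> 'a::banach \<Rightarrow>\<^sub>L 'a"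
    and A :: "('a \<times> 'a) set"
    and B :: "'a \<Rightarrow>\<^sub>L 'a"
    and j :: "'v::banach \<Rightarrow>\<^sub>L 'a"
    and C \<alpha> :: real
  assumes "C0_semigroup T" and "generator T = A"
    and "continuous_embedding j"
    and "C \<ge> 1" and "\<alpha> > 0"
    and "ultracontractive_bound j T \<alpha> C"
    and "\<forall>t\<in>{0<..1}. opnorm_le (op_VV j (T t)) C"
    and "blinfun_apply B ` range (blinfun_apply j) \<subseteq> range (blinfun_apply j)"
    and "C0_semigroup S" and "generator S = add_bounded A B"
  shows "\<exists>C'\<ge>1. ultracontractive_bound j S \<alpha> C'"
proof -
  note T = \<open>C0_semigroup T\<close> and S = \<open>C0_semigroup S\<close>
    and XV = \<open>ultracontractive_bound j T \<alpha> C\<close>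
  have inj: "inj (blinfun_apply j)" using assms(3) by (simp add: continuous_embedding_def)
  have gen: "generator S = add_bounded (generator T) B" using assms(2,10) by simp
  obtain M where M: "M \<ge> 1" "\<And>t. 0 \<le> t \<Longrightarrow> t \<le> 1 \<Longrightarrow> norm (T t) \<le> M"
    using C0_semigroup_bounded[OF T] by blast
  obtain N where N: "N \<ge> 1" "\<And>t. 0 \<le> t \<Longrightarrow> t \<le> 1 \<Longrightarrow> norm (S t) \<le> N"
    using C0_semigroup_bounded[OF S] by blast
  note B = restriction_bounded_linear[OF inj assms(8)]
  obtain b where b: "0 \<le> b" "\<And>v. norm (op_VV j B v) \<le> b * norm v"
    using bounded_linear.nonneg_bounded[OF B(1)] by (auto simp: mult.commute)
  \<comment> \<open>The sum of the two nonnegative constants that \<open>r\<close> has to make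
    small, so that \<open>r * K \<le> 1 / 2\<close> gives both conditions. The 1 in the denominator
    of \<open>r\<close> ensures \<open>r \<le> 1\<close> and covers \<open>K = 0\<close>.\<close>
  define K where "K = M * norm B + C * 2 powr \<alpha> * (norm B + b)"
  define r where "r = 1 / (1 + 2 * K)"
  have parts: "0 \<le> M * norm B" "0 \<le> C * 2 powr \<alpha> * (norm B + b)"
    using M(1) assms(4) b(1) by auto
  then have "0 \<le> K" by (simp add: K_def)
  then have r: "0 < r" "r \<le> 1" and rK: "r * K \<le> 1 / 2" by (auto simp: r_def field_simps)
  have rM: "r * (M * norm B) \<le> 1 / 2" and rC: "r * (C * 2 powr \<alpha> * (norm B + b)) \<le> 1 / 2"
    using rK mult_nonneg_nonneg[OF less_imp_le[OF r(1)] parts(1)]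
      mult_nonneg_nonneg[OF less_imp_le[OF r(1)] parts(2)]
    unfolding K_def distrib_left[of r "M * norm B"] by linarith+
  \<comment> \<open>The iteration needs one constant for the bound of \<open>T s x\<close> in X and
    for its weighted bound in V.\<close>
  define D where "D = max C M"
  have D: "C \<le> D" "M \<le> D" "1 \<le> D" using assms(4) by (auto simp: D_def)
  \<comment> \<open>The factor 2 is the sum of the geometric series that bounds the
    iterates.\<close>
  have small: "bounded_preimage j (S t x) (2 * D * norm x * t powr (- \<alpha>))" if t: "t \<in> {0<..r}" for t x
  proof (rule bounded_preimage_sums)
    show "(\<lambda>n. (variation T B ^^ n) (\<lambda>s. T s x) t) sums S t x"
      using M r rM t by (intro perturbed_semigroup_series[OF T S gen, of M r]) auto
    show "bounded_preimage j ((variation T B ^^ n) (\<lambda>s. T s x) t)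
        (D * norm x * (1 / 2) ^ n * t powr (- \<alpha>))" for n
    proof (rule bounded_preimage_variation_iterate[OF T M(2) _ inj _ assms(5) XV assms(7) B(2) b(2,1) r rM rC _ _ _ t])
      show "continuous_on {0..r} (\<lambda>s. T s x)"
        using r by (intro C0_semigroup_continuous_on[OF T] continuous_intros) auto
      show "norm (T s x) \<le> D * norm x" if "s \<in> {0..r}" for s
        using norm_blinfun[of "T s" x] mult_right_mono[OF order_trans[OF M(2)[of s] D(2)] norm_ge_zero[of x]] that r by auto
      show "bounded_preimage j (T s x) (D * norm x * s powr (- \<alpha>))" if "s \<in> {0<..r}" for s
      proof -
        have s: "s \<in> {0<..1}" using that r by auto
        note op_XV_apply[OF XV s, of x]
        moreover have "norm (op_XV j (T s) x) \<le> C * s powr (- \<alpha>) * norm x"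
          using XV s by (intro opnorm_leD) (auto simp: ultracontractive_bound_def)
        moreover have "\<dots> \<le> D * s powr (- \<alpha>) * norm x"
          using D by (intro mult_right_mono) auto
        ultimately show ?thesis
          unfolding bounded_preimage_def by (intro exI[of _ "op_XV j (T s) x"]) (simp add: mult_ac)
      qed
    qed (use M assms(4) in auto)
    have "(\<lambda>n. (D * norm x * t powr (- \<alpha>)) * (1 / 2) ^ n) sums ((D * norm x * t powr (- \<alpha>)) * 2)"
      using sums_mult[OF geometric_sums[of "1/2::real"]] by simp
    then show "(\<lambda>n. D * norm x * (1 / 2) ^ n * t powr (- \<alpha>)) sums (2 * D * norm x * t powr (- \<alpha>))"
      by (simp add: mult_ac)
  qed
  \<comment> \<open>Allows a bound uniform in time to be weakened to one with the required
    singularity.\<close>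
  have powr1: "1 \<le> s powr (- \<alpha>)" if "s \<in> {0<..1}" for s
    using powr_mono2'[of "- \<alpha>" s 1] that assms(5) by simp
  \<comment> \<open>\<open>r powr (- \<alpha>)\<close> is the cost of smoothing by
    \<open>S r\<close>, and \<open>N\<close> bounds \<open>S (t - r)\<close> on X when
    \<open>t > r\<close>.\<close>
  define C' where "C' = 2 * D * N * r powr (- \<alpha>)"
  have N_le: "1 \<le> N * r powr (- \<alpha>)"
    using mult_mono[OF N(1) powr1[of r]] r N(1) by simp
  have C'_ge: "2 * D \<le> C'"
    using mult_left_mono[OF N_le, of "2 * D"] D by (simp add: C'_def mult.assoc)
  then have C'1: "2 * D \<le> C'" "1 \<le> C'" using D by linarith+
  have "bounded_preimage j (S t x) (norm x * (C' * t powr (- \<alpha>)))" if t: "t \<in> {0<..1}" for t x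
  proof (cases "t \<le> r")
    case True
    have "2 * D * norm x * t powr (- \<alpha>) \<le> C' * norm x * t powr (- \<alpha>)"
      using C'1 by (intro mult_right_mono) auto
    with small[of t x] True t show ?thesis by (auto intro: bounded_preimage_mono simp: mult_ac)
  next
    case False
    \<comment> \<open>\<open>S r\<close> acts last and maps into V; before it,
      \<open>S (t - r)\<close> only has to be bounded on X.\<close>
    have "S t = S r o\<^sub>L S (t - r)"
      using S False r unfolding C0_semigroup_def by (metis add.commute diff_add_cancel diff_ge_0_iff_ge less_imp_le not_le)
    then have "bounded_preimage j (S t x) (2 * D * norm (S (t - r) x) * r powr (- \<alpha>))"
      using small[of r "S (t - r) x"] r by simp
    moreover have "2 * D * norm (S (t - r) x) * r powr (- \<alpha>) \<le> norm x * (C' * t powr (- \<alpha>))"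
    proof -
      have "norm (S (t - r) x) \<le> N * norm x"
        using norm_blinfun[of "S (t - r)" x] mult_right_mono[OF N(2)[of "t - r"] norm_ge_zero[of x]] False t r by auto
      then have "2 * D * norm (S (t - r) x) * r powr (- \<alpha>) \<le> 2 * D * (N * norm x) * r powr (- \<alpha>)"
        using D by (intro mult_right_mono mult_left_mono) auto
      also have "\<dots> = norm x * C' * 1" by (simp add: C'_def)
      also have "\<dots> \<le> norm x * C' * t powr (- \<alpha>)"
        using C'1 powr1[OF t] by (intro mult_left_mono) auto
      finally show ?thesis by (simp add: mult.assoc)
    qed
    ultimately show ?thesis by (rule bounded_preimage_mono)
  qed
  then have "ultracontractive_bound j S \<alpha> C'"
    unfolding ultracontractive_bound_def using C'1 by (auto intro!: opnorm_le_op_XV[OF inj])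
  with C'1 show ?thesis by blast
qed

end
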